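(* Let $A\in\mathbb{R}^{m\times n}$, let $k\ge 1$, $s\ge 0$, $p\ge 0$ be integers, and let $\Omega\in\mathbb{R}^{n\times(k+s)}$ be such that $A\Omega$ has full column rank $k+s$. Then, in exact arithmetic and with the same matrix $\Omega$, the algorithm rSVD-PI is equivalent to the basic rSVD algorithm: the set of all triples $(U,S,V)$ that rSVD-PI can output coincides, up to listing the $k$ singular triplets in reversed order, with the set of all triples $(U,S,V)$ that basic rSVD can output. Here "listing in reversed order" means replacing $(U,S,V)$ by $(UJ,\,JSJ,\,VJ)$ with $J\in\mathbb{R}^{k\times k}$ the order-reversing permutation matrix. (The two algorithms are defined in the context.)
   Context: All matrices are real and all computations are in exact arithmetic. $\mathrm{range}(X)$ is the column space of $X$. In practice $\Omega$ is a Gaussian i.i.d. random matrix; here it is treated as a given matrix shared by both algorithms. Subroutines (each may return any matrices satisfying its specification; the "possible outputs" of an algorithm are all those arising from admissible choices of the subroutines): - $\mathrm{orth}(X)$, for $X$ of full column rank: a matrix of the same size as $X$ with orthonormal columns and the same column space as $X$ (e.g. the $Q$ factor of an economic QR factorization). - $\mathrm{svd}(B)$: an economic SVD $B=USV^{\mathrm T}$, where for $B\in\mathbb{R}^{r\times n}$ with $r\le n$: $U\in\mathbb{R}^{r\times r}$ is orthogonal, $V\in\mathbb{R}^{n\times r}$ has orthonormal columns, and $S\in\mathbb{R}^{r\times r}$ is diagonal with nonnegative entries in descending order. - $\mathrm{lu}(K)$, for $K\in\mathbb{R}^{m\times r}$ of full column rank: compute a pivoted LU factorization $PK=LU$ ($P$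 an $m\times m$ permutation matrix, $L\in\mathbb{R}^{m\times r}$ lower triangular (trapezoidal) with unit diagonal, $U\in\mathbb{R}^{r\times r}$ upper triangular); the first output of $\mathrm{lu}(K)$ is $P^{\mathrm T}L$. - $\mathrm{eigSVD}(A)$, for $A\in\mathbb{R}^{m\times n}$ with $m\ge n$ and full column rank: (1) $B=A^{\mathrm T}A$; (2) $[V,D]=\mathrm{eig}(B)$, i.e. $B=VDV^{\mathrm T}$ with $V$ orthogonal and $D$ diagonal with entries in ascending order; (3) $S=D^{1/2}$ (entrywise square root of the diagonal); (4) $U=AVS^{-1}$. Output: $[U,S,V]$. Basic rSVD (input $A,\Omega,k,s,p$): 1. $Q=\mathrm{orth}(A\Omega)$. 2. For $i=1,\dots,p$: $G=\mathrm{orth}(A^{\mathrm T}Q)$; $Q=\mathrm{orth}(AG)$. 3. $B=Q^{\mathrm T}A$; $[U,S,V]=\mathrm{svd}(B)$; $U=QU$. 4. Output the first $k$ columns of $U$, the leading $k\times k$ block of $S$, and the first $k$ columns of $V$. rSVD-PI (input $A,\Omega,k,s,p$): 1. $Q=A\Omega$. 2. For $i=0,1,\dots,p$: if $i<p$, replace $Q$ by the first output of $\mathrm{lu}(Q)$ and then set $Q=A(A^{\mathrm T}Q)$; if $i=p$, replace $Q$ by the first output of $\mathrm{eigSVD}(Q)$ and leave the loop. 3. $B=Q^{\mathrm T}A$; $[V,S,U]=\mathrm{eigSVD}(B^{\mathrm T})$. 4. With $ind=\{s+1,\dots,s+k\}$, output $U=Q\,U(:,ind)$, $S=S(ind,ind)$,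 $V=V(:,ind)$. *)

theory Defs
  imports
    "HOL-Combinatorics.Permutations"
    "Jordan_Normal_Form.DL_Rank"
    "Jordan_Normal_Form.DL_Submatrix"
begin

text \<open>
  A subroutine that may return any matrices meeting its specification is modelled by the set of
  all its admissible outputs. Its requirements on the argument are part of the specification,
  so outside its domain a subroutine has no output. Matrix indices start at 0.
\<close>

definition full_column_rank :: "real mat \<Rightarrow> bool" where
  "full_column_rank X \<longleftrightarrow> vec_space.rank (dim_row X) X = dim_col X"

text \<open>The library's \<^const>\<open>orthogonal_mat\<close> only asks for nonzero, pairwise orthogonal columns;
  here the columns also have unit length.\<close>

definition orthonormal_columns :: "real mat \<Rightarrow> bool" where
  "orthonormal_columns X \<longleftrightarrow> X\<^sup>T * X = 1\<^sub>m (dim_col X)"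

definition permutation_matrix :: "nat \<Rightarrow> real mat \<Rightarrow> bool" where
  "permutation_matrix m P \<longleftrightarrow>
     (\<exists>\<sigma>. \<sigma> permutes {..<m} \<and> P = mat m m (\<lambda>(i, j). if j = \<sigma> i then 1 else 0))"

definition orth :: "real mat \<Rightarrow> real mat set" where
  "orth X = {Q. full_column_rank X \<and>
     Q \<in> carrier_mat (dim_row X) (dim_col X) \<and> orthonormal_columns Q \<and>
     vec_space.col_space (dim_row X) Q = vec_space.col_space (dim_row X) X}"

definition svd :: "real mat \<Rightarrow> (real mat \<times> real mat \<times> real mat) set" where
  "svd B = {(U, S, V). let r = dim_row B; n = dim_col B in r \<le> n \<and>
     U \<in> carrier_mat r r \<and> orthonormal_columns U \<and>
     V \<in> carrier_mat n r \<and> orthonormal_columns V \<and>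
     S \<in> carrier_mat r r \<and> diagonal_mat S \<and>
     (\<forall>i<r. 0 \<le> S $$ (i, i)) \<and> (\<forall>j<r. \<forall>i\<le>j. S $$ (j, j) \<le> S $$ (i, i)) \<and>
     B = U * S * V\<^sup>T}"

definition lu_first :: "real mat \<Rightarrow> real mat set" where
  "lu_first K = {P\<^sup>T * L | P L U. let m = dim_row K; r = dim_col K in full_column_rank K \<and>
     permutation_matrix m P \<and>
     L \<in> carrier_mat m r \<and> (\<forall>i<m. \<forall>j<r. i < j \<longrightarrow> L $$ (i, j) = 0) \<and>
     (\<forall>j<r. L $$ (j, j) = 1) \<and>
     U \<in> carrier_mat r r \<and> upper_triangular U \<and>
     P * K = L * U}"

definition eig :: "real mat \<Rightarrow> (real mat \<times> real mat) set" where
  "eig B = {(V, D). let n = dim_row B in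
     V \<in> carrier_mat n n \<and> orthonormal_columns V \<and>
     D \<in> carrier_mat n n \<and> diagonal_mat D \<and>
     (\<forall>j<n. \<forall>i\<le>j. D $$ (i, i) \<le> D $$ (j, j)) \<and>
     B = V * D * V\<^sup>T}"

text \<open>The matrix \<open>T\<close> below is the inverse of \<open>S\<close>. Applying \<^const>\<open>sqrt\<close> to all entries of \<open>D\<close>
  leaves the zeros off the diagonal unchanged.\<close>

definition eigSVD :: "real mat \<Rightarrow> (real mat \<times> real mat \<times> real mat) set" where
  "eigSVD A = {(U, S, V). dim_col A \<le> dim_row A \<and> full_column_rank A \<and>
     (\<exists>D T. (V, D) \<in> eig (A\<^sup>T * A) \<and> S = map_mat sqrt D \<and>
        inverts_mat S T \<and> inverts_mat T S \<and> U = A * V * T)}"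

definition basic_rsvd_step :: "real mat \<Rightarrow> real mat \<Rightarrow> real mat \<Rightarrow> bool" where
  "basic_rsvd_step A Q Q' \<longleftrightarrow> (\<exists>G. G \<in> orth (A\<^sup>T * Q) \<and> Q' \<in> orth (A * G))"

text \<open>The parameter \<open>s\<close> only determines the size of \<open>\<Omega>\<close>.\<close>

definition basic_rsvd ::
  "real mat \<Rightarrow> real mat \<Rightarrow> nat \<Rightarrow> nat \<Rightarrow> nat \<Rightarrow> (real mat \<times> real mat \<times> real mat) set" where
  "basic_rsvd A \<Omega> k s p =
     {(submatrix (Q * U) UNIV {..<k}, submatrix S {..<k} {..<k}, submatrix V UNIV {..<k}) |
        Q0 Q U S V.
        Q0 \<in> orth (A * \<Omega>) \<and> (basic_rsvd_step A ^^ p) Q0 Q \<and> (U, S, V) \<in> svd (Q\<^sup>T * A)}"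

definition rsvd_pi_step :: "real mat \<Rightarrow> real mat \<Rightarrow> real mat \<Rightarrow> bool" where
  "rsvd_pi_step A Q Q' \<longleftrightarrow> (\<exists>L. L \<in> lu_first Q \<and> Q' = A * (A\<^sup>T * L))"

text \<open>The loop over \<open>i = 0, \<dots>, p\<close> consists of \<open>p\<close> power steps (\<open>i < p\<close>), ending in \<open>Q1\<close>, and a
  final orthonormalisation by \<^const>\<open>eigSVD\<close> (\<open>i = p\<close>). The output called \<open>V\<close> in the tuple is the
  first, and \<open>U\<close> the last, component of the decomposition of the transposed matrix.\<close>

definition rsvd_pi ::
  "real mat \<Rightarrow> real mat \<Rightarrow> nat \<Rightarrow> nat \<Rightarrow> nat \<Rightarrow> (real mat \<times> real mat \<times> real mat) set" where
  "rsvd_pi A \<Omega> k s p =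
     {(Q * submatrix U UNIV {s..<s + k}, submatrix S {s..<s + k} {s..<s + k},
       submatrix V UNIV {s..<s + k}) |
        Q1 Q S1 V1 U S V.
        (rsvd_pi_step A ^^ p) (A * \<Omega>) Q1 \<and> (Q, S1, V1) \<in> eigSVD Q1 \<and>
        (V, S, U) \<in> eigSVD ((Q\<^sup>T * A)\<^sup>T)}"

definition reversal_mat :: "nat \<Rightarrow> real mat" where
  "reversal_mat k = mat k k (\<lambda>(i, j). if i + j + 1 = k then 1 else 0)"

definition reverse_triplets ::
  "nat \<Rightarrow> real mat \<times> real mat \<times> real mat \<Rightarrow> real mat \<times> real mat \<times> real mat" where
  "reverse_triplets k = (\<lambda>(U, S, V).
     (U * reversal_mat k, reversal_mat k * S * reversal_mat k, V * reversal_mat k))"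

end

theory Submission
  imports Defs "Jordan_Normal_Form.Spectral_Radius"
begin

text \<open>
  Let \<open>W\<close> be the \<open>p\<close>-th power iterate \<open>(A A\<^sup>T)\<^sup>p A \<Omega>\<close>. All subroutines of the loops only
  change the basis of the column space, and \<open>A A\<^sup>T\<close> is injective on the range of \<open>A\<close>. Hence the
  matrices \<open>Q\<close> reachable in the basic algorithm are exactly the orthonormal bases of the range of
  \<open>W\<close>, while those of rSVD-PI form a nonempty subset of them. Two such bases differ by an orthogonal
  factor, \<open>Q = Q' M\<close>, and an SVD \<open>U S V\<^sup>T\<close> of \<open>Q\<^sup>T A\<close> corresponds to the SVD \<open>(M U) S V\<^sup>T\<close>
  of \<open>Q'\<^sup>T A\<close>; since \<open>Q' (M U) = Q U\<close>, the choice of the basis does not affect the output.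
  For a matrix of full column rank, eigSVD produces exactly the singular value decompositions with
  ascending singular values, which are the reversals of those with descending ones.
  Nonemptiness needs the existence of pivoted LU factorisations and of orthogonal diagonalisations of
  symmetric matrices.
\<close>

subsection \<open>Rank and the spectral theorem for symmetric real matrices\<close>

lemma mat_mult_unit_vec:
  fixes X :: "'a :: semiring_1 mat"
  assumes "X \<in> carrier_mat m r" and "j < r"
  shows "X *\<^sub>v unit_vec r j = col X j"
  using assms by (intro eq_vecI) auto

lemma scalar_prod_self_eq_0_iff:
  fixes v :: "real vec"
  assumes "v \<in> carrier_vec n"
  shows "v \<bullet> v = 0 \<longleftrightarrow> v = 0\<^sub>v n"
  using conjugate_square_eq_0_vec[OF assms] by simp

lemma scalar_prod_self_nonneg: "v \<bullet> v \<ge> 0" for v :: "real vec"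
  using conjugate_square_ge_0_vec[of v] by simp

text \<open>A trivial kernel is the form of full rank that all later arguments use. Independence is
  a property of the set of columns, which hides repetitions, so both directions first show that the
  columns are distinct.\<close>

lemma full_column_rank_iff:
  "full_column_rank X \<longleftrightarrow>
     (\<forall>v\<in>carrier_vec (dim_col X). X *\<^sub>v v = 0\<^sub>v (dim_row X) \<longrightarrow> v = 0\<^sub>v (dim_col X))"
proof -
  interpret vec_space "TYPE(real)" "dim_row X" .
  have X: "X \<in> carrier_mat (dim_row X) (dim_col X)" by simp
  show ?thesis
  proof
    assume "full_column_rank X"
    hence r: "rank X = dim_col X" by (simp add: full_column_rank_def)
    have "distinct (cols X)"
    proof (rule ccontr)
      assume nd: "\<not> distinct (cols X)"
      \<comment> \<open>The rank is the size of a maximal independent set of columns. With a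
        repeated column there are fewer than \<open>dim_col X\<close> distinct ones to choose
        from.\<close>
      obtain S where S: "maximal S (\<lambda>T. T \<subseteq> set (cols X) \<and> lin_indpt T)"
        using maximal_exists[of "(\<lambda>T. T \<subseteq> set (cols X) \<and> lin_indpt T)" "card (set (cols X))" "{}"]
        by (meson List.finite_set card_mono empty_iff empty_subsetI finite_lin_indpt2 rev_finite_subset)
      hence "card S \<le> card (set (cols X))" by (simp add: card_mono maximal_def)
      also have "\<dots> < dim_col X"
        using nd card_distinct[of "cols X"] card_length[of "cols X"] by fastforce
      finally show False using r rank_card_indpt[OF X S] by simp
    qed
    with full_rank_lin_indpt[OF X r] lin_depI[OF X]
    show "\<forall>v\<in>carrier_vec (dim_col X). X *\<^sub>v v = 0\<^sub>v (dim_row X) \<longrightarrow> v = 0\<^sub>v (dim_col X)"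
      by blast
  next
    assume inj: "\<forall>v\<in>carrier_vec (dim_col X). X *\<^sub>v v = 0\<^sub>v (dim_row X) \<longrightarrow> v = 0\<^sub>v (dim_col X)"
    have "distinct (cols X)"
    proof (rule ccontr)
      assume "\<not> distinct (cols X)"
      then obtain i j where ij: "i < dim_col X" "j < dim_col X" "i \<noteq> j" "col X i = col X j"
        by (auto simp: distinct_conv_nth)
      \<comment> \<open>Two equal columns would put the difference of two unit vectors into the
        kernel.\<close>
      let ?v = "unit_vec (dim_col X) i - unit_vec (dim_col X) j :: real vec"
      have "X *\<^sub>v ?v = X *\<^sub>v unit_vec (dim_col X) i - X *\<^sub>v unit_vec (dim_col X) j"
        by (rule mult_minus_distrib_mat_vec[OF X]) auto
      also have "\<dots> = col X i - col X j"
        using mat_mult_unit_vec[OF X ij(1)] mat_mult_unit_vec[OF X ij(2)] by simp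
      also have "\<dots> = 0\<^sub>v (dim_row X)" using ij by simp
      finally have "X *\<^sub>v ?v = 0\<^sub>v (dim_row X)" .
      from inj[rule_format, OF _ this] have "?v = 0\<^sub>v (dim_col X)" by simp
      hence "?v $ i = 0" using ij by simp
      thus False using ij by simp
    qed
    moreover from this have "lin_indpt (set (cols X))"
      using lin_depE[OF X] inj by metis
    ultimately show "full_column_rank X"
      unfolding full_column_rank_def by (intro lin_indpt_full_rank[OF X])
  qed
qed

section \<open>Spectral theorem for symmetric real matrices\<close>

text \<open>Over the complex numbers the spectrum is nonempty. For an eigenvector \<open>z\<close>,
  moving the symmetric real matrix across the Hermitian product shows that \<open>e\<close> and its
  conjugate agree, so \<open>e\<close> is real.\<close>

lemma symmetric_real_eigenvalue_exists:
  fixes A :: "real mat"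
  assumes A: "A \<in> carrier_mat n n" and sym: "A\<^sup>T = A" and n: "n > 0"
  shows "\<exists>e. eigenvalue A e"
proof -
  interpret of_real_hom: inj_comm_ring_hom "of_real :: real \<Rightarrow> complex"
    by unfold_locales auto
  let ?A = "map_mat complex_of_real A"
  have cA: "?A \<in> carrier_mat n n" using A by simp
  obtain e where "eigenvalue ?A e"
    using spectrum_non_empty[OF cA n] by (auto simp: spectrum_def)
  then obtain z where z: "z \<in> carrier_vec n" "z \<noteq> 0\<^sub>v n" "?A *\<^sub>v z = e \<cdot>\<^sub>v z"
    using cA by (auto simp: eigenvalue_def eigenvector_def)
  have symc: "?A\<^sup>T = ?A"
    by (subst (2) sym[symmetric]) (auto intro!: eq_matI)
  have conj: "?A *\<^sub>v conjugate z = conjugate (?A *\<^sub>v z)"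
    using A z(1) by (intro eq_vecI) (auto simp: scalar_prod_def row_def)
  have "e * (z \<bullet>c z) = (?A *\<^sub>v z) \<bullet>c z" using z by simp
  also have "\<dots> = z \<bullet> (?A *\<^sub>v conjugate z)"
    using transpose_vec_mult_scalar[OF cA, of "conjugate z" z] z symc by simp
  also have "\<dots> = z \<bullet> conjugate (e \<cdot>\<^sub>v z)" by (simp add: conj z)
  also have "\<dots> = conjugate e * (z \<bullet>c z)" using z by (simp add: conjugate_smult_vec)
  finally have "e = cnj e" using z by simp
  then obtain a where a: "e = of_real a"
    by (metis Reals_cnj_iff Reals_cases)
  have "eigenvalue ?A (of_real a)" using \<open>eigenvalue ?A e\<close> a by simp
  \<comment> \<open>The characteristic polynomial of \<open>?A\<close> is the image of that of
    \<open>A\<close> under the embedding, so its real root is already a root over the reals.\<close>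
  hence "poly (char_poly ?A) (of_real a) = 0"
    using eigenvalue_root_char_poly[OF cA] by simp
  hence "poly (char_poly A) a = 0"
    by (simp add: of_real_hom.char_poly_hom[OF A])
  thus ?thesis using eigenvalue_root_char_poly[OF A] by blast
qed

text \<open>Complete \<open>v\<close> to a basis and apply Gram-Schmidt, which leaves the first
  vector unchanged.\<close>

lemma orthonormal_columns_extend:
  assumes v: "v \<in> carrier_vec n" and unit: "v \<bullet> v = 1"
  shows "\<exists>H\<in>carrier_mat n n. orthonormal_columns H \<and> col H 0 = v"
proof -
  interpret cof_vec_space n "TYPE(real)" .
  have v0: "v \<noteq> 0\<^sub>v n" using v unit by auto
  have n: "n > 0" using v unit by (cases n) (auto simp: scalar_prod_def)
  note bc = basis_completion[OF v v0]
  define ws where "ws = gram_schmidt n (basis_completion v)"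
  note ws = gram_schmidt_result[OF bc(2) bc(4) bc(5) ws_def]
  have "hd ws = v"
    using bc(6,7) n v gram_schmidt_hd unfolding ws_def
    by (metis list.exhaust_sel list.size(3) not_gr_zero)
  have len: "length ws = n" using ws bc by simp
  have ws0: "ws ! 0 = v" using \<open>hd ws = v\<close> len n by (metis hd_conv_nth list.size(3) less_irrefl)
  have wsc: "ws ! i \<in> carrier_vec n" if "i < n" for i
    using ws(3) len that by auto
  have o: "ws ! i \<bullet> ws ! j = 0 \<longleftrightarrow> i \<noteq> j" if "i < n" "j < n" for i j
    using corthogonalD[OF ws(2)] that len by simp
  \<comment> \<open>Gram-Schmidt yields nonzero orthogonal vectors, so \<open>f\<close> still has to
    normalise them. It fixes \<open>v\<close>, which has unit length.\<close>
  define f where "f w = (1 / sqrt (w \<bullet> w)) \<cdot>\<^sub>v w" for w :: "real vec"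
  define H where "H = mat_of_cols n (map f ws)"
  have H: "H \<in> carrier_mat n n" using len by (simp add: H_def mat_of_cols_def)
  have colH: "col H i = f (ws ! i)" if "i < n" for i
    unfolding H_def using that len wsc[OF that] by (subst col_mat_of_cols) (auto simp: f_def)
  have "H\<^sup>T * H = 1\<^sub>m n"
  proof (rule eq_matI)
    fix i j assume "i < dim_row (1\<^sub>m n :: real mat)" "j < dim_col (1\<^sub>m n :: real mat)"
    hence ij: "i < n" "j < n" by auto
    have "(H\<^sup>T * H) $$ (i, j) = f (ws ! i) \<bullet> f (ws ! j)" using ij H colH by simp
    also have "\<dots> = 1 / sqrt (ws ! i \<bullet> ws ! i) * (1 / sqrt (ws ! j \<bullet> ws ! j)) * (ws ! i \<bullet> ws ! j)"
      using wsc[OF ij(1)] wsc[OF ij(2)] by (simp add: f_def)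
    also have "\<dots> = (if i = j then 1 else 0)"
      using o[OF ij] scalar_prod_self_nonneg[of "ws ! i"] by auto
    finally show "(H\<^sup>T * H) $$ (i, j) = 1\<^sub>m n $$ (i, j)" using ij by simp
  qed (use H in auto)
  moreover have "col H 0 = v" using colH[OF n] ws0 unit by (simp add: f_def)
  ultimately show ?thesis using H by (auto simp: orthonormal_columns_def)
qed

text \<open>Deflation: in an orthonormal basis starting with a unit eigenvector, the matrix splits
  into the eigenvalue and a symmetric block of size \<open>n\<close>, to which the induction
  hypothesis applies.\<close>

lemma symmetric_real_diagonalizable:
  fixes A :: "real mat"
  assumes "A \<in> carrier_mat n n" and "A\<^sup>T = A"
  shows "\<exists>V D. (V, D) \<in> eig A"
  using assms
proof (induction n arbitrary: A)
  case 0
  hence "(1\<^sub>m 0, A) \<in> eig A"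
    by (auto simp: eig_def orthonormal_columns_def diagonal_mat_def intro!: eq_matI)
  thus ?case by blast
next
  case (Suc n)
  note A = Suc.prems(1)
  \<comment> \<open>Splitting off the least eigenvalue first makes the diagonal ascending without a sorting step.\<close>
  let ?E = "{e. eigenvalue A e}"
  have fin: "finite ?E" using card_finite_spectrum(1)[OF A] by (simp add: spectrum_def)
  have ne: "?E \<noteq> {}" using symmetric_real_eigenvalue_exists[OF Suc.prems] by auto
  define e where "e = Min ?E"
  have "eigenvalue A e" using Min_in[OF fin ne] by (simp add: e_def)
  have min: "e \<le> x" if "eigenvalue A x" for x using Min_le[OF fin, of x] that by (simp add: e_def)
  obtain w where w: "w \<in> carrier_vec (Suc n)" "w \<noteq> 0\<^sub>v (Suc n)" "A *\<^sub>v w = e \<cdot>\<^sub>v w"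
    using \<open>eigenvalue A e\<close> A by (auto simp: eigenvalue_def eigenvector_def)
  define v where "v = (1 / sqrt (w \<bullet> w)) \<cdot>\<^sub>v w"
  have v: "v \<in> carrier_vec (Suc n)" using w by (simp add: v_def)
  have "w \<bullet> w > 0"
    using scalar_prod_self_eq_0_iff[OF w(1)] scalar_prod_self_nonneg[of w] w(2) by simp
  hence unit: "v \<bullet> v = 1" using w by (simp add: v_def)
  have Av: "A *\<^sub>v v = e \<cdot>\<^sub>v v"
    using w A by (simp add: v_def mult_mat_vec smult_smult_assoc mult.commute)
  obtain H where H: "H \<in> carrier_mat (Suc n) (Suc n)" "H\<^sup>T * H = 1\<^sub>m (Suc n)" "col H 0 = v"
    using orthonormal_columns_extend[OF v unit] by (auto simp: orthonormal_columns_def)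
  have HH: "H * H\<^sup>T = 1\<^sub>m (Suc n)"
    using mat_mult_left_right_inverse[OF _ H(1) H(2)] H(1) by simp
  define B where "B = H\<^sup>T * A * H"
  have B: "B \<in> carrier_mat (Suc n) (Suc n)" using H A by (simp add: B_def)
  have "B\<^sup>T = H\<^sup>T * (H\<^sup>T * A)\<^sup>T"
    unfolding B_def using H(1) A by (subst transpose_mult[of _ "Suc n" "Suc n" _ "Suc n"]) auto
  also have "(H\<^sup>T * A)\<^sup>T = A * H"
    using H(1) A Suc.prems(2) by (subst transpose_mult[of _ "Suc n" "Suc n" _ "Suc n"]) auto
  finally have Bsym: "B\<^sup>T = B" unfolding B_def using H(1) A by simp
  have AHB: "A = H * B * H\<^sup>T"
  proof -
    have "H * B * H\<^sup>T = (H * H\<^sup>T) * A * (H * H\<^sup>T)"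
      unfolding B_def using H(1) A by (simp add: assoc_mult_mat[of _ "Suc n" "Suc n" _ "Suc n" _ "Suc n"])
    thus ?thesis using A by (simp add: HH)
  qed
  \<comment> \<open>Column 0 of \<open>A * H\<close> is \<open>e\<close> times column 0 of
    \<open>H\<close>, and orthonormality turns it into \<open>e\<close> times the first unit vector.
    Row 0 then follows from the symmetry of \<open>B\<close>.\<close>
  have Bi0: "B $$ (i, 0) = (if i = 0 then e else 0)" if i: "i < Suc n" for i
  proof -
    have "B $$ (i, 0) = row H\<^sup>T i \<bullet> col (A * H) 0"
      unfolding B_def using H(1) A i by (simp add: assoc_mult_mat[of _ "Suc n" "Suc n" _ "Suc n" _ "Suc n"])
    also have "col (A * H) 0 = e \<cdot>\<^sub>v v"
      using col_mult2[OF A H(1), of 0] H(3) Av by simp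
    also have "row H\<^sup>T i \<bullet> (e \<cdot>\<^sub>v v) = e * (row H\<^sup>T i \<bullet> col H 0)" using H i v by simp
    also have "row H\<^sup>T i \<bullet> col H 0 = (H\<^sup>T * H) $$ (i, 0)" using H(1) i by simp
    finally show ?thesis using H(2) i by simp
  qed
  have B0j: "B $$ (0, j) = (if j = 0 then e else 0)" if j: "j < Suc n" for j
    using Bi0[OF j] B j Bsym by (metis carrier_matD(1,2) index_transpose_mat(1) zero_less_Suc)
  define C where "C = mat n n (\<lambda>(i, j). B $$ (Suc i, Suc j))"
  have C: "C \<in> carrier_mat n n" by (simp add: C_def)
  have Bs: "B $$ (i, j) = B $$ (j, i)" if "i < Suc n" "j < Suc n" for i j
    using that B Bsym by (metis carrier_matD(1,2) index_transpose_mat(1))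
  have "C\<^sup>T = C" by (rule eq_matI) (auto simp: C_def intro: Bs)
  from Suc.IH[OF C this] obtain V D where VD: "(V, D) \<in> eig C" by blast
  hence V: "V \<in> carrier_mat n n" "V\<^sup>T * V = 1\<^sub>m n" and D: "D \<in> carrier_mat n n" "diagonal_mat D"
    and asc: "\<And>i j. j < n \<Longrightarrow> i \<le> j \<Longrightarrow> D $$ (i, i) \<le> D $$ (j, j)" and CVD: "C = V * D * V\<^sup>T"
    using C by (auto simp: eig_def orthonormal_columns_def Let_def)
  let ?Z = "0\<^sub>m 1 n :: real mat" and ?Z' = "0\<^sub>m n 1 :: real mat"
  let ?e = "mat 1 1 (\<lambda>_. e)"
  define V' where "V' = four_block_mat (1\<^sub>m 1) ?Z ?Z' V"
  define D' where "D' = four_block_mat ?e ?Z ?Z' D"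
  have V': "V' \<in> carrier_mat (Suc n) (Suc n)" and D': "D' \<in> carrier_mat (Suc n) (Suc n)"
    using four_block_carrier_mat[of "1\<^sub>m 1" 1 1 V n n] four_block_carrier_mat[of ?e 1 1 D n n] V D
    by (auto simp: V'_def D'_def)
  have V'T: "V'\<^sup>T = four_block_mat (1\<^sub>m 1) ?Z ?Z' V\<^sup>T"
    unfolding V'_def using V by (subst transpose_four_block_mat[of _ 1 1 _ n _ n]) auto
  have oV': "V'\<^sup>T * V' = 1\<^sub>m (Suc n)"
    unfolding V'T unfolding V'_def using V
    by (subst mult_four_block_mat[of _ 1 1 _ n _ n _ _ 1 _ n]) (auto simp del: One_nat_def)
  have "B = four_block_mat ?e ?Z ?Z' C"
    using B Bi0 B0j by (intro eq_matI) (auto simp: C_def)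
  also have "\<dots> = V' * D' * V'\<^sup>T"
    unfolding V'T unfolding V'_def D'_def CVD using V D
    by (subst mult_four_block_mat[of _ 1 1 _ n _ n _ _ 1 _ n]; (subst mult_four_block_mat[of _ 1 1 _ n _ n _ _ 1 _ n])?)
       (auto simp del: One_nat_def)
  finally have B_eq: "B = V' * D' * V'\<^sup>T" .
  have dD': "diagonal_mat D'"
    using D by (auto simp: D'_def diagonal_mat_def)
  define W where "W = H * V'"
  have W: "W \<in> carrier_mat (Suc n) (Suc n)" using H V' by (simp add: W_def)
  have WT: "W\<^sup>T = V'\<^sup>T * H\<^sup>T" unfolding W_def using H V' by (simp add: transpose_mult)
  note assoc = assoc_mult_mat[of _ "Suc n" "Suc n" _ "Suc n" _ "Suc n"]
  have "W\<^sup>T * W = V'\<^sup>T * (H\<^sup>T * H) * V'"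
    unfolding WT unfolding W_def using H(1) V' by (simp add: assoc)
  hence oW: "W\<^sup>T * W = 1\<^sub>m (Suc n)" using H(2) V' oV' by simp
  have A_eq: "A = W * D' * W\<^sup>T"
    unfolding AHB B_eq WT unfolding W_def using H(1) V' D' by (simp add: assoc)
  \<comment> \<open>The columns of \<open>W\<close> are eigenvectors of \<open>A\<close> for the
    diagonal entries of \<open>D'\<close>. None of these entries is below the minimum
    \<open>e\<close>, which justifies its first place; the order of the others comes from the
    induction.\<close>
  have ev: "eigenvalue A (D' $$ (j, j))" if j: "j < Suc n" for j
  proof -
    have "A * W = W * D' * (W\<^sup>T * W)" 
      by (subst A_eq) (use W D' in \<open>simp add: assoc\<close>)
    hence AW: "A * W = W * D'" using oW W D' by simp
    have "A *\<^sub>v col W j = col (A * W) j" using col_mult2[OF A W j] by simp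
    also have "\<dots> = W *\<^sub>v col D' j" unfolding AW using col_mult2[OF W D' j] by simp
    also have "col D' j = D' $$ (j, j) \<cdot>\<^sub>v unit_vec (Suc n) j"
      using D' dD' j by (intro eq_vecI) (auto simp: diagonal_mat_def unit_vec_def)
    also have "W *\<^sub>v \<dots> = D' $$ (j, j) \<cdot>\<^sub>v (W *\<^sub>v unit_vec (Suc n) j)"
      using W by (simp add: mult_mat_vec)
    also have "W *\<^sub>v unit_vec (Suc n) j = col W j" using mat_mult_unit_vec[OF W j] .
    finally have "A *\<^sub>v col W j = D' $$ (j, j) \<cdot>\<^sub>v col W j" .
    moreover have "col W j \<noteq> 0\<^sub>v (Suc n)"
    proof
      assume "col W j = 0\<^sub>v (Suc n)"
      moreover have "(W\<^sup>T * W) $$ (j, j) = col W j \<bullet> col W j" using W j by simp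
      ultimately show False using oW j by simp
    qed
    ultimately have "eigenvector A (col W j) (D' $$ (j, j))"
      using A W col_carrier_vec[OF j W] by (simp add: eigenvector_def)
    thus ?thesis by (auto simp: eigenvalue_def)
  qed
  have "D' $$ (i, i) \<le> D' $$ (j, j)" if ij: "j < Suc n" "i \<le> j" for i j
  proof (cases i)
    case 0
    have "D' $$ (0, 0) = e" using D by (simp add: D'_def)
    thus ?thesis using min[OF ev[OF ij(1)]] 0 by simp
  next
    case (Suc i')
    thus ?thesis using ij D asc[of "j - 1" i'] by (cases j) (auto simp: D'_def)
  qed
  hence "(W, D') \<in> eig A"
    using A W oW D' dD' A_eq by (auto simp: eig_def orthonormal_columns_def)
  thus ?case by blast
qed

subsection \<open>Pivoted LU factorisation and column spaces\<close>

text \<open>Matrices are given by their entry functions here, so that the dimensions may vary in the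
  induction on the number of columns.\<close>

lemma pivoted_lu_exists:
  fixes K :: "nat \<Rightarrow> nat \<Rightarrow> real"
  assumes "\<forall>x. (\<forall>i<m. (\<Sum>j<r. K i j * x j) = 0) \<longrightarrow> (\<forall>j<r. x j = 0)"
  shows "r \<le> m \<and> (\<exists>\<sigma> L U. \<sigma> permutes {..<m} \<and> (\<forall>i<m. \<forall>j<r. i < j \<longrightarrow> L i j = 0) \<and>
     (\<forall>j<r. L j j = 1) \<and> (\<forall>i j. j < i \<longrightarrow> U i j = 0) \<and>
     (\<forall>i<m. \<forall>j<r. K (\<sigma> i) j = (\<Sum>l<r. L i l * U l j)))"
  using assms
proof (induction r arbitrary: m K)
  case 0
  show ?case by (intro conjI exI[of _ id] exI[of _ "\<lambda>_ _. 0"]) (auto simp: permutes_id[unfolded id_def])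
next
  case (Suc r)
  have inj: "x j = 0"
    if "\<And>i. i < m \<Longrightarrow> (\<Sum>j<Suc r. K i j * x j) = 0" "j < Suc r" for x j
    using Suc.prems that by blast
  \<comment> \<open>A vanishing first column would put the first unit vector into the
    kernel.\<close>
  have "\<exists>p<m. K p 0 \<noteq> 0"
  proof (rule ccontr)
    assume "\<not> (\<exists>p<m. K p 0 \<noteq> 0)"
    hence "(\<Sum>j<Suc r. K i j * (if j = 0 then 1 else 0)) = 0" if "i < m" for i
      using that by (simp add: sum.lessThan_Suc_shift del: sum.lessThan_Suc)
    from inj[OF this, of 0] show False by simp
  qed
  then obtain p where p: "p < m" "K p 0 \<noteq> 0" by blast
  obtain m' where m: "m = Suc m'" using p by (cases m) auto
  define \<tau> where "\<tau> = transpose 0 p"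
  have \<tau>: "\<tau> permutes {..<m}" unfolding \<tau>_def using p by (intro permutes_swap_id) auto
  define K' where "K' i j = K (\<tau> i) j" for i j
  define a where "a = K' 0 0"
  have a: "a \<noteq> 0" using p by (simp add: a_def K'_def \<tau>_def)
  \<comment> \<open>the Schur complement of the pivot\<close>
  define S where "S i j = K' (Suc i) (Suc j) - K' (Suc i) 0 * K' 0 (Suc j) / a" for i j
  have inj': "x j = 0" if x: "\<And>i. i < m' \<Longrightarrow> (\<Sum>j<r. S i j * x j) = 0" and j: "j < r" for x j
  proof -
    \<comment> \<open>The new leading coefficient solves the pivot row. With it, the row sums of
      \<open>K'\<close> below the pivot become those of the Schur complement, so a kernel vector
      \<open>x\<close> of \<open>S\<close> extends to a kernel vector \<open>y\<close> of
      \<open>K'\<close>.\<close>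
    define y where "y = case_nat (- (\<Sum>j<r. K' 0 (Suc j) * x j) / a) x"
    have K'0: "(\<Sum>j<Suc r. K' i j * y j) = 0" if i: "i < m" for i
    proof (cases i)
      case 0
      thus ?thesis using a by (simp add: sum.lessThan_Suc_shift y_def a_def del: sum.lessThan_Suc)
    next
      case (Suc i')
      have "(\<Sum>j<Suc r. K' i j * y j) = (\<Sum>j<r. S i' j * x j)"
        by (simp add: Suc sum.lessThan_Suc_shift y_def S_def sum_subtractf algebra_simps
              sum_distrib_left sum_divide_distrib del: sum.lessThan_Suc)
      thus ?thesis using x[of i'] i Suc m by simp
    qed
    \<comment> \<open>The swap \<open>\<tau>\<close> is an involution, so row \<open>i\<close> of
      \<open>K\<close> is row \<open>\<tau> i\<close> of \<open>K'\<close>.\<close>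
    have "(\<Sum>j<Suc r. K i j * y j) = 0" if i: "i < m" for i
    proof -
      have "\<tau> i < m" using permutes_in_image[OF \<tau>, of i] i by simp
      from K'0[OF this] show ?thesis by (simp add: K'_def \<tau>_def)
    qed
    from inj[OF this, of "Suc j"] j show ?thesis by (simp add: y_def)
  qed
  hence "\<forall>x. (\<forall>i<m'. (\<Sum>j<r. S i j * x j) = 0) \<longrightarrow> (\<forall>j<r. x j = 0)" by blast
  from Suc.IH[OF this] obtain \<sigma> L U where rm: "r \<le> m'"
    and \<sigma>: "\<sigma> permutes {..<m'}" and L0: "\<forall>i<m'. \<forall>j<r. i < j \<longrightarrow> L i j = 0"
    and L1: "\<forall>j<r. L j j = 1" and U: "\<forall>i j. j < i \<longrightarrow> U i j = 0"
    and LU: "\<forall>i<m'. \<forall>j<r. S (\<sigma> i) j = (\<Sum>l<r. L i l * U l j)" by blast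
  \<comment> \<open>The pivot row stays first, and \<open>\<sigma>\<close> permutes the rows below
    it.\<close>
  define \<rho> where "\<rho> = case_nat 0 (\<lambda>i. Suc (\<sigma> i))"
  have "\<rho> permutes {..<m}"
  proof (rule inj_imp_permutes)
    show "inj_on \<rho> {..<m}"
      using inj_eq[OF permutes_inj[OF \<sigma>]]
      by (intro inj_onI) (simp add: \<rho>_def split: nat.splits)
    show "\<rho> x \<in> {..<m}" if "x \<in> {..<m}" for x
      using that permutes_in_image[OF \<sigma>] by (auto simp: \<rho>_def m split: nat.splits)
    show "\<rho> x = x" if "x \<notin> {..<m}" for x
      using that permutes_not_in[OF \<sigma>] by (auto simp: \<rho>_def m split: nat.splits)
  qed auto
  hence perm: "\<tau> \<circ> \<rho> permutes {..<m}" by (rule permutes_compose[OF _ \<tau>])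
  \<comment> \<open>The multipliers in the first column of \<open>L'\<close> are listed in the order
    \<open>\<sigma>\<close>, because later pivoting moves them together with their rows.\<close>
  define L' where "L' i l = (case l of
      0 \<Rightarrow> (case i of 0 \<Rightarrow> 1 | Suc i' \<Rightarrow> K' (Suc (\<sigma> i')) 0 / a)
    | Suc l' \<Rightarrow> (case i of 0 \<Rightarrow> 0 | Suc i' \<Rightarrow> L i' l'))" for i l
  define U' where "U' l j = (case l of 0 \<Rightarrow> K' 0 j
    | Suc l' \<Rightarrow> (case j of 0 \<Rightarrow> 0 | Suc j' \<Rightarrow> U l' j'))" for l j
  have eq: "K ((\<tau> \<circ> \<rho>) i) j = (\<Sum>l<Suc r. L' i l * U' l j)" if ij: "i < m" "j < Suc r" for i j
  proof -
    have "K ((\<tau> \<circ> \<rho>) i) j = K' (\<rho> i) j" by (simp add: K'_def)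
    also have "\<dots> = (\<Sum>l<Suc r. L' i l * U' l j)"
    proof (cases i)
      case 0
      thus ?thesis
        by (simp add: sum.lessThan_Suc_shift L'_def U'_def \<rho>_def del: sum.lessThan_Suc)
    next
      case (Suc i')
      show ?thesis
      proof (cases j)
        case 0
        with Suc a show ?thesis
          by (simp add: sum.lessThan_Suc_shift L'_def U'_def \<rho>_def a_def del: sum.lessThan_Suc)
      next
        case j: (Suc j')
        have "(\<Sum>l<r. L i' l * U l j') = S (\<sigma> i') j'"
          using LU ij Suc j m by simp
        with Suc j show ?thesis
          by (simp add: sum.lessThan_Suc_shift L'_def U'_def \<rho>_def S_def del: sum.lessThan_Suc)
      qed
    qed
    finally show ?thesis .
  qed
  have "\<forall>i<m. \<forall>j<Suc r. i < j \<longrightarrow> L' i j = 0" "\<forall>j<Suc r. L' j j = 1"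
    "\<forall>i j. j < i \<longrightarrow> U' i j = 0"
    using L0 L1 U m by (auto simp: L'_def U'_def split: nat.splits)
  thus ?case using perm eq rm m by blast
qed

lemma full_column_rank_sum:
  assumes "full_column_rank X" and "X \<in> carrier_mat m r"
  shows "\<forall>x. (\<forall>i<m. (\<Sum>j<r. X $$ (i, j) * x j) = 0) \<longrightarrow> (\<forall>j<r. x j = 0)"
proof (intro allI impI)
  fix x j
  assume x: "\<forall>i<m. (\<Sum>j<r. X $$ (i, j) * x j) = 0" and j: "j < r"
  have "X *\<^sub>v vec r x = 0\<^sub>v m"
    using assms(2) x by (intro eq_vecI) (auto simp: scalar_prod_def atLeast0LessThan)
  hence "vec r x = 0\<^sub>v r" using assms(1,2) by (auto simp: full_column_rank_iff)
  hence "vec r x $ j = 0" using j by simp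
  thus "x j = 0" using j by simp
qed

text \<open>Elimination uses up one row per column, so this bound comes with the LU
  factorisation.\<close>

lemma full_column_rank_dim_le:
  assumes "full_column_rank X"
  shows "dim_col X \<le> dim_row X"
  using pivoted_lu_exists[OF full_column_rank_sum[OF assms carrier_matI[OF refl refl]]] by simp

lemma lu_first_nonempty:
  assumes K: "full_column_rank K"
  shows "\<exists>L. L \<in> lu_first K"
proof -
  let ?m = "dim_row K" and ?r = "dim_col K"
  obtain \<sigma> L U where \<sigma>: "\<sigma> permutes {..<?m}" and L0: "\<forall>i<?m. \<forall>j<?r. i < j \<longrightarrow> L i j = 0"
    and L1: "\<forall>j<?r. L j j = 1" and U: "\<forall>i j. j < i \<longrightarrow> U i j = (0 :: real)"
    and LU: "\<forall>i<?m. \<forall>j<?r. K $$ (\<sigma> i, j) = (\<Sum>l<?r. L i l * U l j)" and rm: "?r \<le> ?m"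
    using pivoted_lu_exists[OF full_column_rank_sum[OF K carrier_matI[OF refl refl]]] by auto
  \<comment> \<open>Row \<open>i\<close> of \<open>P * K\<close> is row \<open>\<sigma> i\<close> of
    \<open>K\<close>, which matches the row order of the entrywise factorisation.\<close>
  define P where "P = mat ?m ?m (\<lambda>(i, j). if j = \<sigma> i then 1 else 0 :: real)"
  have "(P * K) $$ (i, j) = K $$ (\<sigma> i, j)" if "i < ?m" "j < ?r" for i j
  proof -
    have "\<sigma> i < ?m" using permutes_in_image[OF \<sigma>, of i] that by simp
    thus ?thesis
      using that by (simp add: P_def scalar_prod_def if_distrib[of "\<lambda>x. x * _"] cong: if_cong)
  qed
  hence "P * K = mat ?m ?r (\<lambda>(i, j). L i j) * mat ?r ?r (\<lambda>(i, j). U i j)"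
    using LU by (intro eq_matI) (auto simp: P_def scalar_prod_def atLeast0LessThan)
  moreover have "permutation_matrix ?m P" using \<sigma> by (auto simp: permutation_matrix_def P_def)
  ultimately have "P\<^sup>T * mat ?m ?r (\<lambda>(i, j). L i j) \<in> lu_first K"
    using K L0 L1 U rm unfolding lu_first_def Let_def
    by (intro CollectI exI[of _ P] exI[of _ "mat ?m ?r (\<lambda>(i, j). L i j)"]
          exI[of _ "mat ?r ?r (\<lambda>(i, j). U i j)"]) auto
  thus ?thesis by blast
qed

text \<open>Reindexing the sum of an entry by \<open>\<sigma>\<close> leaves a product of two
  Kronecker deltas.\<close>

lemma permutation_matrix_transpose_mult:
  assumes "permutation_matrix m P"
  shows "P\<^sup>T * P = 1\<^sub>m m"
proof -
  obtain \<sigma> where \<sigma>: "\<sigma> permutes {..<m}"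
    and P: "P = mat m m (\<lambda>(i, j). if j = \<sigma> i then 1 else 0)"
    using assms by (auto simp: permutation_matrix_def)
  show ?thesis
  proof (rule eq_matI)
    fix i j assume "i < dim_row (1\<^sub>m m :: real mat)" "j < dim_col (1\<^sub>m m :: real mat)"
    hence ij: "i < m" "j < m" by auto
    let ?g = "\<lambda>l. (if i = l then 1 else 0) * (if j = l then 1 else 0 :: real)"
    have "(P\<^sup>T * P) $$ (i, j) = (\<Sum>l<m. (?g \<circ> \<sigma>) l)"
      using ij by (simp add: P scalar_prod_def atLeast0LessThan)
    also have "\<dots> = sum ?g {..<m}" using sum.permute[OF \<sigma>, of ?g] by simp
    also have "\<dots> = (if i = j then 1 else 0)"
      using ij by (simp add: if_distrib[of "\<lambda>x. x * _"] cong: if_cong)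
    finally show "(P\<^sup>T * P) $$ (i, j) = 1\<^sub>m m $$ (i, j)" using ij by simp
  qed (auto simp: P)
qed

section \<open>Ranks and column spaces under multiplication\<close>

lemma full_column_rank_square_inverse:
  assumes X: "X \<in> carrier_mat n n" and rk: "full_column_rank X"
  obtains Y where "Y \<in> carrier_mat n n" "X * Y = 1\<^sub>m n" "Y * X = 1\<^sub>m n"
proof -
  have "det X \<noteq> 0"
    using det_0_iff_vec_prod_zero_field[OF X] rk X by (auto simp: full_column_rank_iff)
  from det_non_zero_imp_unit[OF X this, of "()"] show ?thesis
    using that by (auto simp: Units_def ring_mat_def)
qed

lemma full_column_rank_factor:
  assumes X: "X \<in> carrier_mat m r" and Y: "Y \<in> carrier_mat l m" and "full_column_rank (Y * X)"
  shows "full_column_rank X"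
  unfolding full_column_rank_iff
proof (intro ballI impI)
  fix v assume v: "v \<in> carrier_vec (dim_col X)" "X *\<^sub>v v = 0\<^sub>v (dim_row X)"
  hence "(Y * X) *\<^sub>v v = 0\<^sub>v l" using X Y by (auto intro!: eq_vecI)
  thus "v = 0\<^sub>v (dim_col X)" using assms v by (auto simp: full_column_rank_iff)
qed

lemma full_column_rank_one: "full_column_rank (1\<^sub>m n)"
  by (auto simp: full_column_rank_iff)

lemma orthonormal_columns_full_column_rank:
  assumes "orthonormal_columns X"
  shows "full_column_rank X"
  using full_column_rank_factor[of X "dim_row X" "dim_col X" "X\<^sup>T" "dim_col X"] assms
  by (simp add: orthonormal_columns_def full_column_rank_one)

lemma orthonormal_columns_square:
  assumes X: "X \<in> carrier_mat n n" and "orthonormal_columns X"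
  shows "X * X\<^sup>T = 1\<^sub>m n"
  using mat_mult_left_right_inverse[of "X\<^sup>T" n X] assms by (auto simp: orthonormal_columns_def)

text \<open>The rank is the dimension of the column space, so it does not see the choice of the
  spanning columns.\<close>

lemma full_column_rank_cong:
  assumes "dim_row X = dim_row Y" "dim_col X = dim_col Y"
    and "vec_space.col_space (dim_row X) X = vec_space.col_space (dim_row X) Y"
  shows "full_column_rank X \<longleftrightarrow> full_column_rank Y"
  using assms by (simp add: full_column_rank_def vec_space.rank_def vec_space.col_space_def)

lemma col_space_eq_image:
  fixes X :: "'a :: field mat"
  assumes "X \<in> carrier_mat m r"
  shows "vec_space.col_space m X = (*\<^sub>v) X ` carrier_vec r"
  using assms vec_space.col_space_eq[OF assms] by auto

lemma col_space_mult:
  fixes X Y :: "'a :: field mat"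
  assumes Y: "Y \<in> carrier_mat l m" and X: "X \<in> carrier_mat m r"
  shows "vec_space.col_space l (Y * X) = (*\<^sub>v) Y ` vec_space.col_space m X"
proof -
  have "Y * X \<in> carrier_mat l r" using X Y by simp
  from col_space_eq_image[OF this] show ?thesis
    using X Y by (simp add: col_space_eq_image[OF X] image_image)
qed

text \<open>The right inverse makes \<open>M\<close> surjective on coefficient vectors, so the same
  linear combinations of the columns of \<open>X\<close> arise.\<close>

lemma col_space_mult_right:
  fixes X M N :: "'a :: field mat"
  assumes X: "X \<in> carrier_mat m r" and M: "M \<in> carrier_mat r r" and N: "N \<in> carrier_mat r r"
    and inv: "M * N = 1\<^sub>m r"
  shows "vec_space.col_space m (X * M) = vec_space.col_space m X"
proof -
  have "v \<in> (*\<^sub>v) M ` carrier_vec r" if v: "v \<in> carrier_vec r" for v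
  proof
    show "v = M *\<^sub>v (N *\<^sub>v v)"
      using assoc_mult_mat_vec[OF M N v] inv v by simp
  qed (rule mult_mat_vec_carrier[OF N v])
  hence "(*\<^sub>v) M ` carrier_vec r = carrier_vec r" using M by auto
  thus ?thesis
    by (simp add: col_space_mult[OF X M] col_space_eq_image[OF X] col_space_eq_image[OF M])
qed

lemma col_space_subset_factor:
  fixes X Y :: "'a :: field mat"
  assumes X: "X \<in> carrier_mat m r" and Y: "Y \<in> carrier_mat m q"
    and sub: "vec_space.col_space m Y \<subseteq> vec_space.col_space m X"
  obtains M where "M \<in> carrier_mat r q" "Y = X * M"
proof -
  have "\<exists>x\<in>carrier_vec r. X *\<^sub>v x = col Y j" if j: "j < q" for j
  proof -
    have "Y *\<^sub>v unit_vec q j \<in> vec_space.col_space m Y"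
      by (auto simp: col_space_eq_image[OF Y])
    hence "col Y j \<in> vec_space.col_space m X" using sub mat_mult_unit_vec[OF Y j] by auto
    thus ?thesis by (force simp: col_space_eq_image[OF X])
  qed
  then obtain x where x: "\<And>j. j < q \<Longrightarrow> x j \<in> carrier_vec r \<and> X *\<^sub>v x j = col Y j" by metis
  \<comment> \<open>Column \<open>j\<close> of \<open>M\<close> collects the coefficients of column
    \<open>j\<close> of \<open>Y\<close> with respect to the columns of \<open>X\<close>.\<close>
  define M where "M = mat r q (\<lambda>(i, j). x j $ i)"
  have M: "M \<in> carrier_mat r q" by (simp add: M_def)
  have cM: "col M j = x j" if "j < q" for j
    using x[OF that] that by (intro eq_vecI) (auto simp: M_def)
  have "Y = X * M"
  proof (rule mat_col_eqI)
    fix j assume "j < dim_col (X * M)"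
    hence j: "j < q" using M by simp
    show "col Y j = col (X * M) j" using col_mult2[OF X M j] cM[OF j] x[OF j] by simp
  qed (use X Y M in auto)
  with M show ?thesis using that by blast
qed

text \<open>Since \<open>P\<^sup>T * P\<close> is the identity, \<open>K\<close> equals
  \<open>L * U\<close>. Full rank of \<open>K\<close> makes the square factor \<open>U\<close>
  invertible, so the step merely changes the basis.\<close>

lemma lu_first_col_space:
  assumes "L \<in> lu_first K"
  shows "L \<in> carrier_mat (dim_row K) (dim_col K)"
    and "vec_space.col_space (dim_row K) L = vec_space.col_space (dim_row K) K"
proof -
  let ?m = "dim_row K" and ?r = "dim_col K"
  obtain P L' U where L: "L = P\<^sup>T * L'" and rk: "full_column_rank K"
    and P: "permutation_matrix ?m P" and L': "L' \<in> carrier_mat ?m ?r"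
    and U: "U \<in> carrier_mat ?r ?r" and PK: "P * K = L' * U"
    using assms by (auto simp: lu_first_def Let_def)
  have K: "K \<in> carrier_mat ?m ?r" by simp
  have Pc: "P \<in> carrier_mat ?m ?m" using P by (auto simp: permutation_matrix_def)
  show Lc: "L \<in> carrier_mat ?m ?r" using L L' Pc by simp
  have "K = (P\<^sup>T * P) * K" by (simp add: permutation_matrix_transpose_mult[OF P])
  also have "\<dots> = P\<^sup>T * (P * K)" using Pc by (intro assoc_mult_mat[of _ ?m ?m _ ?m _ ?r]) auto
  also have "\<dots> = L * U" unfolding PK L using Pc L' U by simp
  finally have KLU: "K = L * U" .
  have "full_column_rank U"
    using full_column_rank_factor[OF U Lc] rk KLU by simp
  from full_column_rank_square_inverse[OF U this] obtain N
    where "N \<in> carrier_mat ?r ?r" "U * N = 1\<^sub>m ?r" by blast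
  from col_space_mult_right[OF Lc U this]
  show "vec_space.col_space ?m L = vec_space.col_space ?m K" by (simp flip: KLU)
qed

subsection \<open>The eigenvalue-based SVD\<close>

lemma diagonal_mult_index:
  fixes S Y :: "'a :: semiring_1 mat"
  assumes S: "S \<in> carrier_mat n n" "diagonal_mat S" and Y: "Y \<in> carrier_mat n q"
    and ij: "i < n" "j < q"
  shows "(S * Y) $$ (i, j) = S $$ (i, i) * Y $$ (i, j)"
proof -
  have "(S * Y) $$ (i, j) = (\<Sum>l = 0..<n. S $$ (i, l) * Y $$ (l, j))"
    using S Y ij by (simp add: scalar_prod_def)
  also have "\<dots> = (\<Sum>l = 0..<n. if l = i then S $$ (i, i) * Y $$ (i, j) else 0)"
    using S ij by (intro sum.cong) (auto simp: diagonal_mat_def)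
  finally show ?thesis using ij by simp
qed

lemma diagonal_mat_transpose:
  fixes S :: "'a :: zero mat"
  assumes "S \<in> carrier_mat n n" "diagonal_mat S"
  shows "S\<^sup>T = S"
proof (rule eq_matI)
  fix i j assume "i < dim_row S" "j < dim_col S"
  thus "S\<^sup>T $$ (i, j) = S $$ (i, j)"
    using assms by (cases "i = j") (auto simp: diagonal_mat_def)
qed (use assms in auto)

lemma diagonal_mult_diagonal:
  fixes S T :: "'a :: semiring_1 mat"
  assumes "S \<in> carrier_mat n n" "diagonal_mat S" and "T \<in> carrier_mat n n" "diagonal_mat T"
  shows "diagonal_mat (S * T)"
proof -
  have "(S * T) $$ (i, j) = 0" if "i < n" "j < n" "i \<noteq> j" for i j
    using that assms diagonal_mult_index[OF assms(1-3) that(1,2)] by (auto simp: diagonal_mat_def)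
  thus ?thesis using assms by (auto simp: diagonal_mat_def simp del: index_mult_mat(1))
qed

text \<open>If the Gram matrix kills \<open>v\<close>, then the squared length of
  \<open>X *\<^sub>v v\<close> is zero.\<close>

lemma gram_full_column_rank:
  assumes X: "X \<in> carrier_mat m r" and rk: "full_column_rank X"
  shows "full_column_rank (X\<^sup>T * X)"
  unfolding full_column_rank_iff
proof (intro ballI impI)
  fix v assume "v \<in> carrier_vec (dim_col (X\<^sup>T * X))"
    and Xv: "(X\<^sup>T * X) *\<^sub>v v = 0\<^sub>v (dim_row (X\<^sup>T * X))"
  hence v: "v \<in> carrier_vec r" using X by simp
  have "X\<^sup>T *\<^sub>v (X *\<^sub>v v) = 0\<^sub>v r"
    using Xv X v by (subst assoc_mult_mat_vec[of _ r m _ r, symmetric]) auto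
  hence "(X *\<^sub>v v) \<bullet> (X *\<^sub>v v) = 0"
    using transpose_vec_mult_scalar[OF X v, of "X *\<^sub>v v"] X v by simp
  hence "X *\<^sub>v v = 0\<^sub>v m" using X v scalar_prod_self_eq_0_iff[of "X *\<^sub>v v" m] by simp
  thus "v = 0\<^sub>v (dim_col (X\<^sup>T * X))" using rk X v by (auto simp: full_column_rank_iff)
qed

text \<open>Orthogonality of \<open>V\<close> gives \<open>D = (X * V)\<^sup>T * (X * V)\<close>.
  The diagonal entries of \<open>D\<close> are thus squared column lengths, and their square roots
  multiply back to \<open>D\<close>.\<close>

lemma eig_gram_sqrt:
  assumes X: "X \<in> carrier_mat m r" and eig: "(V, D) \<in> eig (X\<^sup>T * X)"
  defines "S \<equiv> map_mat sqrt D"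
  shows "S \<in> carrier_mat r r" "diagonal_mat S" "\<forall>i<r. 0 \<le> S $$ (i, i)"
    "\<forall>j<r. \<forall>i\<le>j. S $$ (i, i) \<le> S $$ (j, j)" "D = S * S"
proof -
  have V: "V \<in> carrier_mat r r" "V\<^sup>T * V = 1\<^sub>m r" and D: "D \<in> carrier_mat r r" "diagonal_mat D"
    and asc: "\<forall>j<r. \<forall>i\<le>j. D $$ (i, i) \<le> D $$ (j, j)" and XX: "X\<^sup>T * X = V * D * V\<^sup>T"
    using eig X by (auto simp: eig_def orthonormal_columns_def)
  note assoc = assoc_mult_mat[of _ r r _ r _ r]
  have "V\<^sup>T * (X\<^sup>T * X) * V = (V\<^sup>T * V) * D * (V\<^sup>T * V)"
    unfolding XX using V(1) D by (simp add: assoc)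
  hence "D = V\<^sup>T * (X\<^sup>T * X) * V" using V D by simp
  also have "\<dots> = (X * V)\<^sup>T * (X * V)"
    using X V(1) by (simp add: transpose_mult assoc_mult_mat[of _ r r _ m _ r]
        assoc_mult_mat[of _ r r _ r _ r] assoc_mult_mat[of _ r m _ r _ r])
  finally have gram: "D = (X * V)\<^sup>T * (X * V)" .
  have D0: "D $$ (i, i) \<ge> 0" if "i < r" for i
    using that X V scalar_prod_self_nonneg by (subst gram) simp
  show S: "S \<in> carrier_mat r r" and dS: "diagonal_mat S"
    using D by (auto simp: S_def diagonal_mat_def)
  show "\<forall>i<r. 0 \<le> S $$ (i, i)" using D D0 by (auto simp: S_def)
  show "\<forall>j<r. \<forall>i\<le>j. S $$ (i, i) \<le> S $$ (j, j)" using D asc by (auto simp: S_def)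
  show "D = S * S"
  proof (rule eq_matI)
    fix i j assume "i < dim_row (S * S)" "j < dim_col (S * S)"
    hence ij: "i < r" "j < r" using S by auto
    show "D $$ (i, j) = (S * S) $$ (i, j)"
      unfolding diagonal_mult_index[OF S dS S ij]
      using ij D D0[OF ij(1)] by (cases "i = j") (auto simp: S_def diagonal_mat_def)
  qed (use S D in auto)
qed

text \<open>The kernel of a right factor lies in the kernel of the product, and the invertible
  \<open>V\<^sup>T\<close> leaves the column space of \<open>S\<close> unchanged. This is what makes
  \<open>S\<close> invertible in eigSVD.\<close>

lemma full_column_rank_middle:
  assumes X: "U * S * V\<^sup>T = X" and rk: "full_column_rank X"
    and U: "U \<in> carrier_mat m r" and S: "S \<in> carrier_mat r r"
    and V: "V \<in> carrier_mat r r" and oV: "orthonormal_columns V"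
  shows "full_column_rank S" "full_column_rank (S * V\<^sup>T)"
proof -
  have "U * (S * V\<^sup>T) = X" using X U S V by (simp add: assoc_mult_mat[of _ m r _ r _ r])
  thus *: "full_column_rank (S * V\<^sup>T)"
    using full_column_rank_factor[of "S * V\<^sup>T" r r U m] U S V rk by simp
  have "V\<^sup>T * V = 1\<^sub>m r" using oV V by (simp add: orthonormal_columns_def)
  from col_space_mult_right[OF S _ V this] have "vec_space.col_space r (S * V\<^sup>T) = vec_space.col_space r S"
    using V by simp
  with * show "full_column_rank S"
    using full_column_rank_cong[of "S * V\<^sup>T" S] S V by simp
qed

text \<open>Forwards, \<open>U\<^sup>T * U\<close> telescopes to the identity because the Gram
  matrix is \<open>V * (S * S) * V\<^sup>T\<close> and \<open>T\<close> inverts \<open>S\<close>.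
  Backwards, \<open>S * S\<close> serves as \<open>D\<close>, and the rank of \<open>X\<close>
  provides the inverse of \<open>S\<close>. Later arguments can thus forget \<open>D\<close> and
  \<open>T\<close>.\<close>

lemma eigSVD_iff:
  assumes X: "X \<in> carrier_mat m r" and rk: "full_column_rank X"
  shows "(U, S, V) \<in> eigSVD X \<longleftrightarrow>
    U \<in> carrier_mat m r \<and> orthonormal_columns U \<and> V \<in> carrier_mat r r \<and> orthonormal_columns V \<and>
    S \<in> carrier_mat r r \<and> diagonal_mat S \<and> (\<forall>i<r. 0 \<le> S $$ (i, i)) \<and>
    (\<forall>j<r. \<forall>i\<le>j. S $$ (i, i) \<le> S $$ (j, j)) \<and> X = U * S * V\<^sup>T"
    (is "?lhs \<longleftrightarrow> ?rhs")
proof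
  assume ?lhs
  then obtain D T where eig: "(V, D) \<in> eig (X\<^sup>T * X)" and S: "S = map_mat sqrt D"
    and T: "inverts_mat S T" "inverts_mat T S" and U: "U = X * V * T"
    by (auto simp: eigSVD_def)
  note gram = eig_gram_sqrt[OF X eig, folded S]
  have V: "V \<in> carrier_mat r r" "orthonormal_columns V" and XX: "X\<^sup>T * X = V * D * V\<^sup>T"
    using eig X by (auto simp: eig_def)
  have VV: "V\<^sup>T * V = 1\<^sub>m r" "V * V\<^sup>T = 1\<^sub>m r"
    using V orthonormal_columns_square[OF V] by (auto simp: orthonormal_columns_def)
  \<comment> \<open>The size of \<open>T\<close> is read off from the column counts of the two
    products that equal identity matrices.\<close>
  have "dim_col T = r"
    using T(1) gram(1) by (metis carrier_matD(1) index_mult_mat(3) index_one_mat(3) inverts_mat_def)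
  moreover have "dim_row T = r"
    using T(2) gram(1) by (metis carrier_matD(2) index_mult_mat(3) index_one_mat(3) inverts_mat_def)
  ultimately have Tc: "T \<in> carrier_mat r r" by auto
  have ST: "S * T = 1\<^sub>m r" "T * S = 1\<^sub>m r"
    using T Tc gram(1) by (auto simp: inverts_mat_def)
  \<comment> \<open>This is the transpose of \<open>S * T = 1\<^sub>m r\<close>, as the diagonal
    matrix \<open>S\<close> is symmetric.\<close>
  have TS: "T\<^sup>T * S = 1\<^sub>m r"
    using transpose_mult[OF gram(1) Tc] ST(1) diagonal_mat_transpose[OF gram(1,2)] by simp
  note assoc = assoc_mult_mat[of _ r r _ r _ r] assoc_mult_mat[of _ m r _ r _ r]
  have Uc: "U \<in> carrier_mat m r" using U X V Tc by simp
  have "U\<^sup>T * U = (T\<^sup>T * V\<^sup>T * X\<^sup>T) * (X * (V * T))"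
    unfolding U using X V(1) Tc by (simp add: transpose_mult[of _ m r _ r] transpose_mult[of _ r r _ r] assoc
      assoc_mult_mat[of _ r r _ r _ m])
  also have "\<dots> = (T\<^sup>T * V\<^sup>T) * (X\<^sup>T * X) * (V * T)"
    using X V(1) Tc
    by (simp add: assoc assoc_mult_mat[of _ r r _ m _ r] assoc_mult_mat[of _ r m _ r _ r])
  also have "\<dots> = T\<^sup>T * (V\<^sup>T * V) * S * (S * ((V\<^sup>T * V) * T))"
    unfolding XX gram(5) using V(1) Tc gram(1) by (simp add: assoc)
  also have "\<dots> = (T\<^sup>T * S) * (S * T)" using VV Tc gram(1) by simp
  also have "\<dots> = 1\<^sub>m r" by (simp add: TS ST)
  finally have oU: "orthonormal_columns U" using Uc by (simp add: orthonormal_columns_def)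
  have "U * S * V\<^sup>T = X * V * (T * S) * V\<^sup>T" unfolding U using X V(1) Tc gram(1) by (simp add: assoc)
  also have "\<dots> = X * (V * V\<^sup>T)" using X V(1) by (simp add: ST assoc)
  finally have "X = U * S * V\<^sup>T" using VV X by simp
  with Uc oU V gram show ?rhs by blast
next
  assume ?rhs
  hence U: "U \<in> carrier_mat m r" and oU: "orthonormal_columns U" and V: "V \<in> carrier_mat r r"
    and oV: "orthonormal_columns V" and S: "S \<in> carrier_mat r r" and dS: "diagonal_mat S"
    and S0: "\<And>i. i < r \<Longrightarrow> 0 \<le> S $$ (i, i)"
    and asc: "\<And>i j. j < r \<Longrightarrow> i \<le> j \<Longrightarrow> S $$ (i, i) \<le> S $$ (j, j)"
    and XUSV: "X = U * S * V\<^sup>T" by auto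
  have VV: "V\<^sup>T * V = 1\<^sub>m r" and UU: "U\<^sup>T * U = 1\<^sub>m r"
    using U V oU oV by (auto simp: orthonormal_columns_def)
  note assoc = assoc_mult_mat[of _ r r _ r _ r] assoc_mult_mat[of _ m r _ r _ r]
  have XT: "X\<^sup>T = V * S * U\<^sup>T"
    unfolding XUSV using U S V diagonal_mat_transpose[OF S dS]
    by (simp add: transpose_mult[of _ m r _ r] transpose_mult[of _ r r _ r]
        assoc assoc_mult_mat[of _ r r _ r _ m])
  have SS: "(S * S) $$ (i, j) = S $$ (i, i) * S $$ (i, j)" if "i < r" "j < r" for i j
    by (rule diagonal_mult_index[OF S dS S that])
  have "X\<^sup>T * X = V * S * (U\<^sup>T * U) * S * V\<^sup>T"
    unfolding XT unfolding XUSV using U S V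
    by (simp add: assoc assoc_mult_mat[of _ r r _ m _ r] assoc_mult_mat[of _ r m _ r _ r])
  also have "\<dots> = V * (S * S) * V\<^sup>T" using S V by (simp add: UU assoc)
  finally have "X\<^sup>T * X = V * (S * S) * V\<^sup>T" .
  moreover have "(S * S) $$ (i, i) \<le> (S * S) $$ (j, j)" if "j < r" "i \<le> j" for i j
    using that SS S0[of i] S0[of j] asc[of j i] by (simp add: mult_mono)
  ultimately have eig: "(V, S * S) \<in> eig (X\<^sup>T * X)"
    using X V oV S diagonal_mult_diagonal[OF S dS S dS] by (auto simp: eig_def)
  \<comment> \<open>The square root recovers the diagonal entries from their squares because they
    are nonnegative.\<close>
  have sqrt: "S = map_mat sqrt (S * S)"
  proof (rule eq_matI)
    fix i j assume "i < dim_row (map_mat sqrt (S * S))" "j < dim_col (map_mat sqrt (S * S))"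
    hence ij: "i < r" "j < r" using S by auto
    thus "S $$ (i, j) = map_mat sqrt (S * S) $$ (i, j)"
      using SS[OF ij] S dS S0[OF ij(1)] by (cases "i = j") (auto simp: diagonal_mat_def)
  qed (use S in auto)
  have "full_column_rank S" using full_column_rank_middle(1)[OF XUSV[symmetric] rk U S V oV] .
  from full_column_rank_square_inverse[OF S this] obtain T where
    T: "T \<in> carrier_mat r r" "S * T = 1\<^sub>m r" "T * S = 1\<^sub>m r" by blast
  have "X * V * T = U * S * (V\<^sup>T * V) * T" unfolding XUSV using U S V T(1) by (simp add: assoc)
  also have "\<dots> = U * (S * T)" using U S T(1) by (simp add: VV assoc)
  finally have "U = X * V * T" using U T by simp
  moreover have "inverts_mat S T" "inverts_mat T S" using S T by (auto simp: inverts_mat_def)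
  moreover have "dim_col X \<le> dim_row X" by (rule full_column_rank_dim_le[OF rk])
  ultimately show ?lhs using rk eig sqrt unfolding eigSVD_def by blast
qed

lemma eigSVD_nonempty:
  assumes X: "X \<in> carrier_mat m r" and rk: "full_column_rank X"
  shows "\<exists>U S V. (U, S, V) \<in> eigSVD X"
proof -
  have XX: "X\<^sup>T * X \<in> carrier_mat r r" "(X\<^sup>T * X)\<^sup>T = X\<^sup>T * X"
    using X by (simp_all add: transpose_mult)
  obtain V D where eig: "(V, D) \<in> eig (X\<^sup>T * X)" using symmetric_real_diagonalizable[OF XX] by blast
  define S where "S = map_mat sqrt D"
  note S = eig_gram_sqrt[OF X eig, folded S_def]
  have V: "V \<in> carrier_mat r r" "orthonormal_columns V" and VDV: "X\<^sup>T * X = V * D * V\<^sup>T"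
    using eig X by (auto simp: eig_def)
  \<comment> \<open>The Gram matrix takes the place of \<open>X\<close> in
    \<open>full_column_rank_middle\<close>, with left factor \<open>V * S\<close>, so its full rank
    passes to \<open>S\<close>.\<close>
  have "(V * S) * S * V\<^sup>T = X\<^sup>T * X"
    unfolding VDV S(5) using V S(1) by (simp add: assoc_mult_mat[of _ r r _ r _ r])
  from full_column_rank_middle(1)[OF this gram_full_column_rank[OF X rk] mult_carrier_mat[OF V(1) S(1)] S(1) V]
  have "full_column_rank S" .
  from full_column_rank_square_inverse[OF S(1) this] obtain T
    where "T \<in> carrier_mat r r" "S * T = 1\<^sub>m r" "T * S = 1\<^sub>m r" by blast
  hence "inverts_mat S T" "inverts_mat T S" using S(1) by (auto simp: inverts_mat_def)
  hence "(X * V * T, S, V) \<in> eigSVD X"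
    using eig rk full_column_rank_dim_le[OF rk] S_def by (auto simp: eigSVD_def)
  thus ?thesis by blast
qed

text \<open>In \<open>X = U * (S * V\<^sup>T)\<close> the right factor is invertible, so
  \<open>U\<close> is an orthonormal basis of the same space and hence an admissible result of
  \<open>orth\<close>.\<close>

lemma eigSVD_orth:
  assumes X: "X \<in> carrier_mat m r" and "(U, S, V) \<in> eigSVD X"
  shows "U \<in> orth X"
proof -
  have rk: "full_column_rank X" using assms(2) by (simp add: eigSVD_def)
  have U: "U \<in> carrier_mat m r" and oU: "orthonormal_columns U" and V: "V \<in> carrier_mat r r"
    and oV: "orthonormal_columns V" and S: "S \<in> carrier_mat r r" and XUSV: "X = U * S * V\<^sup>T"
    using assms(2) unfolding eigSVD_iff[OF X rk] by auto
  have SV: "S * V\<^sup>T \<in> carrier_mat r r" using S V by simp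
  obtain N where N: "N \<in> carrier_mat r r" "S * V\<^sup>T * N = 1\<^sub>m r"
    using full_column_rank_square_inverse[OF SV full_column_rank_middle(2)[OF XUSV[symmetric] rk U S V oV]]
    by blast
  have "X = U * (S * V\<^sup>T)" using XUSV U S V by (simp add: assoc_mult_mat[of _ m r _ r _ r])
  with col_space_mult_right[OF U SV N] have "vec_space.col_space m U = vec_space.col_space m X" by simp
  thus ?thesis using X U oU rk by (simp add: orth_def)
qed

text \<open>The left factor of an eigSVD serves as the witness.\<close>

lemma orth_nonempty:
  assumes "full_column_rank X"
  shows "\<exists>Q. Q \<in> orth X"
  using eigSVD_nonempty[OF carrier_matI[OF refl refl] assms] eigSVD_orth[OF carrier_matI[OF refl refl]]
  by blast

subsection \<open>Power iteration\<close>

lemma orth_dims: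
  assumes "Q \<in> orth X" and "X \<in> carrier_mat m r"
  shows "Q \<in> carrier_mat m r" "orthonormal_columns Q"
    "vec_space.col_space m Q = vec_space.col_space m X" "full_column_rank Q"
  using assms by (auto simp: orth_def orthonormal_columns_full_column_rank)

text \<open>On the range of \<open>A\<close> the transpose is injective: for
  \<open>w = A *\<^sub>v z\<close> with \<open>A\<^sup>T *\<^sub>v w = 0\<close>, the product of
  \<open>w\<close> with itself is that of \<open>A\<^sup>T *\<^sub>v w\<close> with
  \<open>z\<close>, hence zero. The second claim reduces to this, since pairing
  \<open>A *\<^sub>v (A\<^sup>T *\<^sub>v w)\<close> with \<open>w\<close> gives the squared length
  of \<open>A\<^sup>T *\<^sub>v w\<close>.\<close>

lemma full_column_rank_transpose_mult:
  assumes A: "A \<in> carrier_mat m n" and X: "X \<in> carrier_mat m r" and rk: "full_column_rank X"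
    and sub: "vec_space.col_space m X \<subseteq> vec_space.col_space m A"
  shows "full_column_rank (A\<^sup>T * X)" and "full_column_rank (A * (A\<^sup>T * X))"
proof -
  have ATX: "A\<^sup>T * X \<in> carrier_mat n r" using A X by simp
  have X0: "v = 0\<^sub>v r" if v: "v \<in> carrier_vec r" and "X *\<^sub>v v = 0\<^sub>v m" for v
    using rk X that by (auto simp: full_column_rank_iff)
  have AT0: "v = 0\<^sub>v r" if v: "v \<in> carrier_vec r" and 0: "A\<^sup>T *\<^sub>v (X *\<^sub>v v) = 0\<^sub>v n" for v
  proof -
    have "X *\<^sub>v v \<in> vec_space.col_space m A"
      using sub v by (auto simp: col_space_eq_image[OF X])
    then obtain z where z: "z \<in> carrier_vec n" "X *\<^sub>v v = A *\<^sub>v z"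
      by (auto simp: col_space_eq_image[OF A])
    have "(X *\<^sub>v v) \<bullet> (X *\<^sub>v v) = (X *\<^sub>v v) \<bullet> (A *\<^sub>v z)" by (simp only: z(2))
    also have "\<dots> = (A\<^sup>T *\<^sub>v (X *\<^sub>v v)) \<bullet> z"
      by (rule transpose_vec_mult_scalar[symmetric, OF A z(1) mult_mat_vec_carrier[OF X v]])
    also have "\<dots> = 0" unfolding 0 using z(1) by simp
    finally have "X *\<^sub>v v = 0\<^sub>v m"
      using X v scalar_prod_self_eq_0_iff[of "X *\<^sub>v v" m] by simp
    thus ?thesis using X0 v by blast
  qed
  show "full_column_rank (A\<^sup>T * X)"
    unfolding full_column_rank_iff
  proof (intro ballI impI)
    fix v assume v: "v \<in> carrier_vec (dim_col (A\<^sup>T * X))"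
      and 0: "(A\<^sup>T * X) *\<^sub>v v = 0\<^sub>v (dim_row (A\<^sup>T * X))"
    have "A\<^sup>T *\<^sub>v (X *\<^sub>v v) = 0\<^sub>v n"
      using 0 v A X by (subst assoc_mult_mat_vec[of _ n m _ r, symmetric]) auto
    thus "v = 0\<^sub>v (dim_col (A\<^sup>T * X))" using AT0 v X by simp
  qed
  show "full_column_rank (A * (A\<^sup>T * X))"
    unfolding full_column_rank_iff
  proof (intro ballI impI)
    fix v assume "v \<in> carrier_vec (dim_col (A * (A\<^sup>T * X)))"
      and 0: "(A * (A\<^sup>T * X)) *\<^sub>v v = 0\<^sub>v (dim_row (A * (A\<^sup>T * X)))"
    hence v: "v \<in> carrier_vec r" using X by simp
    let ?w = "X *\<^sub>v v"
    have w: "?w \<in> carrier_vec m" using X v by simp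
    have "A *\<^sub>v (A\<^sup>T *\<^sub>v ?w) = 0\<^sub>v m"
      using 0 v A X assoc_mult_mat_vec[OF A ATX v] assoc_mult_mat_vec[of "A\<^sup>T" n m X r v] by simp
    hence "?w \<bullet> (A *\<^sub>v (A\<^sup>T *\<^sub>v ?w)) = 0" using w by simp
    hence "(A\<^sup>T *\<^sub>v ?w) \<bullet> (A\<^sup>T *\<^sub>v ?w) = 0"
      using transpose_vec_mult_scalar[OF A _ w, of "A\<^sup>T *\<^sub>v ?w"] A w by simp
    hence "A\<^sup>T *\<^sub>v ?w = 0\<^sub>v n"
      using A w scalar_prod_self_eq_0_iff[of "A\<^sup>T *\<^sub>v ?w" n] by simp
    thus "v = 0\<^sub>v (dim_col (A * (A\<^sup>T * X)))" using AT0 v X by simp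
  qed
qed

text \<open>The iteration without any change of basis, as a common reference for the column spaces
  in both loops.\<close>

definition power_iterate :: "real mat \<Rightarrow> real mat \<Rightarrow> nat \<Rightarrow> real mat" where
  "power_iterate A X i = ((\<lambda>Y. A * (A\<^sup>T * Y)) ^^ i) X"

lemma power_iterate_simps:
  "power_iterate A X 0 = X"
  "power_iterate A X (Suc i) = A * (A\<^sup>T * power_iterate A X i)"
  by (simp_all add: power_iterate_def)

text \<open>The rank survives a step because the columns lie in the range of \<open>A\<close>, and
  the leading factor \<open>A\<close> puts the new columns there again.\<close>

lemma power_iterate_invariant:
  assumes A: "A \<in> carrier_mat m n" and X: "X \<in> carrier_mat m r" and "full_column_rank X"
    and "vec_space.col_space m X \<subseteq> vec_space.col_space m A"
  shows "power_iterate A X i \<in> carrier_mat m r \<and> full_column_rank (power_iterate A X i) \<and>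
    vec_space.col_space m (power_iterate A X i) \<subseteq> vec_space.col_space m A"
proof (induction i)
  case 0
  show ?case using assms by (simp add: power_iterate_simps)
next
  case (Suc i)
  let ?Y = "power_iterate A X i"
  have Y: "A\<^sup>T * ?Y \<in> carrier_mat n r" using A Suc by simp
  hence "(*\<^sub>v) (A\<^sup>T * ?Y) ` carrier_vec r \<subseteq> carrier_vec n" by auto
  hence "vec_space.col_space m (A * (A\<^sup>T * ?Y)) \<subseteq> vec_space.col_space m A"
    unfolding col_space_mult[OF A Y] col_space_eq_image[OF A] col_space_eq_image[OF Y]
    by (rule image_mono)
  with Suc full_column_rank_transpose_mult(2)[OF A, of ?Y r] A show ?case
    by (simp add: power_iterate_simps)
qed

text \<open>The set \<open>orth\<close> depends only on the size and column space of its argument,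
  so neither the basis \<open>Q\<close> nor the choice of \<open>G\<close> influences the possible
  results of a step.\<close>

lemma basic_rsvd_step_iff:
  assumes A: "A \<in> carrier_mat m n" and X: "X \<in> carrier_mat m r" and rk: "full_column_rank X"
    and sub: "vec_space.col_space m X \<subseteq> vec_space.col_space m A" and Q: "Q \<in> orth X"
  shows "basic_rsvd_step A Q Q' \<longleftrightarrow> Q' \<in> orth (A * (A\<^sup>T * X))"
proof -
  note Q = orth_dims[OF Q X]
  have AT: "A\<^sup>T \<in> carrier_mat n m" using A by simp
  have ATQ: "A\<^sup>T * Q \<in> carrier_mat n r" and ATX: "A\<^sup>T * X \<in> carrier_mat n r"
    using A Q X by auto
  have cs: "vec_space.col_space n (A\<^sup>T * Q) = vec_space.col_space n (A\<^sup>T * X)"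
    by (simp add: col_space_mult[OF AT Q(1)] col_space_mult[OF AT X] Q)
  have "orth (A * G) = orth (A * (A\<^sup>T * X))" if G: "G \<in> orth (A\<^sup>T * Q)" for G
  proof -
    note G = orth_dims[OF G ATQ]
    have AG: "A * G \<in> carrier_mat m r" "A * (A\<^sup>T * X) \<in> carrier_mat m r" using A G ATX by auto
    have "vec_space.col_space m (A * G) = vec_space.col_space m (A * (A\<^sup>T * X))"
      by (simp add: col_space_mult[OF A G(1)] col_space_mult[OF A ATX] G cs)
    thus ?thesis using AG full_column_rank_cong[of "A * G" "A * (A\<^sup>T * X)"] A G(1) X
      by (simp add: orth_def)
  qed
  \<comment> \<open>Without some \<open>G\<close> the step would have no result at all; this gives
    the direction from right to left.\<close>
  moreover have "\<exists>G. G \<in> orth (A\<^sup>T * Q)"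
    using full_column_rank_transpose_mult(1)[OF A Q(1) Q(4)] sub Q(3) by (intro orth_nonempty) simp
  ultimately show ?thesis by (auto simp: basic_rsvd_step_def)
qed

lemma basic_rsvd_loop_iff:
  assumes "A \<in> carrier_mat m n" "X \<in> carrier_mat m r" "full_column_rank X"
    "vec_space.col_space m X \<subseteq> vec_space.col_space m A"
  shows "(\<exists>Q0\<in>orth X. (basic_rsvd_step A ^^ i) Q0 Q) \<longleftrightarrow> Q \<in> orth (power_iterate A X i)"
proof (induction i arbitrary: Q)
  case 0
  show ?case by (auto simp: power_iterate_simps)
next
  case (Suc i)
  have W: "power_iterate A X i \<in> carrier_mat m r" "full_column_rank (power_iterate A X i)"
    "vec_space.col_space m (power_iterate A X i) \<subseteq> vec_space.col_space m A"
    using power_iterate_invariant[OF assms] by auto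
  have "(\<exists>Q0\<in>orth X. (basic_rsvd_step A ^^ Suc i) Q0 Q) \<longleftrightarrow>
    (\<exists>Q'. (\<exists>Q0\<in>orth X. (basic_rsvd_step A ^^ i) Q0 Q') \<and> basic_rsvd_step A Q' Q)"
    by (auto simp: relcompp_apply)
  also have "\<dots> \<longleftrightarrow> (\<exists>Q'\<in>orth (power_iterate A X i). basic_rsvd_step A Q' Q)"
    unfolding Suc.IH by blast
  \<comment> \<open>From right to left some intermediate basis is needed, which
    \<open>orth_nonempty\<close> supplies.\<close>
  also have "\<dots> \<longleftrightarrow> Q \<in> orth (power_iterate A X (Suc i))"
    using basic_rsvd_step_iff[OF assms(1) W] orth_nonempty[OF W(2)]
    by (auto simp: power_iterate_simps)
  finally show ?case .
qed

text \<open>Both the LU step and the products with \<open>A\<^sup>T\<close> and \<open>A\<close> act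
  on column spaces, so \<open>Q\<close> may be compared with any \<open>W\<close> spanning the same
  space; in the loop, \<open>W\<close> is the power iterate.\<close>

lemma rsvd_pi_step_col_space:
  assumes A: "A \<in> carrier_mat m n" and Q: "Q \<in> carrier_mat m r" and W: "W \<in> carrier_mat m r"
    and eq: "vec_space.col_space m Q = vec_space.col_space m W" and "rsvd_pi_step A Q Q'"
  shows "Q' \<in> carrier_mat m r"
    "vec_space.col_space m Q' = vec_space.col_space m (A * (A\<^sup>T * W))"
proof -
  obtain L where L: "L \<in> lu_first Q" and Q': "Q' = A * (A\<^sup>T * L)"
    using assms(5) by (auto simp: rsvd_pi_step_def)
  have Lc: "L \<in> carrier_mat m r" and "vec_space.col_space m L = vec_space.col_space m W"
    using lu_first_col_space[OF L] Q eq by auto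
  moreover have AT: "A\<^sup>T \<in> carrier_mat n m" and ATL: "A\<^sup>T * L \<in> carrier_mat n r"
    and ATW: "A\<^sup>T * W \<in> carrier_mat n r"
    using A Lc W by auto
  ultimately show "vec_space.col_space m Q' = vec_space.col_space m (A * (A\<^sup>T * W))"
    by (simp add: Q' col_space_mult[OF A ATL] col_space_mult[OF A ATW]
        col_space_mult[OF AT Lc] col_space_mult[OF AT W])
  show "Q' \<in> carrier_mat m r" unfolding Q' using A Lc by simp
qed

lemma rsvd_pi_loop_col_space:
  assumes A: "A \<in> carrier_mat m n" and X: "X \<in> carrier_mat m r" and "full_column_rank X"
    and "vec_space.col_space m X \<subseteq> vec_space.col_space m A"
    and "(rsvd_pi_step A ^^ i) X Q"
  shows "Q \<in> carrier_mat m r"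
    "vec_space.col_space m Q = vec_space.col_space m (power_iterate A X i)"
proof -
  have "Q \<in> carrier_mat m r \<and>
    vec_space.col_space m Q = vec_space.col_space m (power_iterate A X i)"
    using assms(5)
  proof (induction i arbitrary: Q)
    case 0
    thus ?case using X by (simp add: power_iterate_simps)
  next
    case (Suc i)
    then obtain Q' where "(rsvd_pi_step A ^^ i) X Q'" and step: "rsvd_pi_step A Q' Q" by auto
    with Suc.IH have Q': "Q' \<in> carrier_mat m r"
      "vec_space.col_space m Q' = vec_space.col_space m (power_iterate A X i)" by auto
    have "power_iterate A X i \<in> carrier_mat m r" using power_iterate_invariant[OF assms(1-4)] by auto
    from rsvd_pi_step_col_space[OF A Q'(1) this Q'(2) step] show ?case
      by (simp add: power_iterate_simps)
  qed
  thus "Q \<in> carrier_mat m r"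
    "vec_space.col_space m Q = vec_space.col_space m (power_iterate A X i)" by auto
qed

lemma rsvd_pi_loop_full_column_rank:
  assumes "A \<in> carrier_mat m n" "X \<in> carrier_mat m r" "full_column_rank X"
    "vec_space.col_space m X \<subseteq> vec_space.col_space m A" and "(rsvd_pi_step A ^^ i) X Q"
  shows "full_column_rank Q"
  using rsvd_pi_loop_col_space[OF assms] power_iterate_invariant[OF assms(1-4), of i]
    full_column_rank_cong[of Q "power_iterate A X i"] by auto

text \<open>Full column rank persists along the loop, so a pivoted LU factorisation is available at
  each step.\<close>

lemma rsvd_pi_loop_exists:
  assumes "A \<in> carrier_mat m n" "X \<in> carrier_mat m r" "full_column_rank X"
    "vec_space.col_space m X \<subseteq> vec_space.col_space m A"
  shows "\<exists>Q. (rsvd_pi_step A ^^ i) X Q"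
proof (induction i)
  case (Suc i)
  then obtain Q where Q: "(rsvd_pi_step A ^^ i) X Q" by blast
  obtain Q' where "rsvd_pi_step A Q Q'"
    using lu_first_nonempty[OF rsvd_pi_loop_full_column_rank[OF assms Q]]
    by (auto simp: rsvd_pi_step_def)
  from relpowp_Suc_I[OF Q this] show ?case by blast
qed auto

text \<open>The last matrix of the loop and the power iterate agree in size and column space, hence
  have the same orthonormal bases.\<close>

lemma eigSVD_power_orth:
  assumes "A \<in> carrier_mat m n" "X \<in> carrier_mat m r" "full_column_rank X"
    "vec_space.col_space m X \<subseteq> vec_space.col_space m A"
    and loop: "(rsvd_pi_step A ^^ i) X Q1" and "(Q, S, V) \<in> eigSVD Q1"
  shows "Q \<in> orth (power_iterate A X i)"
  using eigSVD_orth[OF rsvd_pi_loop_col_space(1)[OF assms(1-4) loop] assms(6)]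
    rsvd_pi_loop_col_space[OF assms(1-4) loop] power_iterate_invariant[OF assms(1-4), of i]
  by (auto simp: orth_def)

subsection \<open>Reversal of the singular triplets\<close>

lemma reversal_mat_simps:
  "reversal_mat r \<in> carrier_mat r r" "dim_row (reversal_mat r) = r" "dim_col (reversal_mat r) = r"
  "(reversal_mat r)\<^sup>T = reversal_mat r"
  by (auto simp: reversal_mat_def add.commute)

lemma mult_reversal_index:
  assumes "X \<in> carrier_mat m r" "i < m" "j < r"
  shows "(X * reversal_mat r) $$ (i, j) = X $$ (i, r - 1 - j)"
proof -
  have "(X * reversal_mat r) $$ (i, j) = (\<Sum>l = 0..<r. X $$ (i, l) * (if l + j + 1 = r then 1 else 0))"
    using assms by (simp add: scalar_prod_def reversal_mat_def)
  \<comment> \<open>For \<open>j < r\<close> the truncated subtraction is exact, so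
    \<open>l = r - 1 - j\<close> is the only solution of \<open>l + j + 1 = r\<close>.\<close>
  also have "\<dots> = (\<Sum>l = 0..<r. if l = r - 1 - j then X $$ (i, l) else 0)"
    using assms(3) by (intro sum.cong) auto
  finally show ?thesis using assms(3) by simp
qed

lemma reversal_mult_index:
  assumes X: "X \<in> carrier_mat r q" and "i < r" "j < q"
  shows "(reversal_mat r * X) $$ (i, j) = X $$ (r - 1 - i, j)"
proof -
  have "(reversal_mat r * X) $$ (i, j) = (\<Sum>l = 0..<r. (if i + l + 1 = r then 1 else 0) * X $$ (l, j))"
    using assms by (simp add: scalar_prod_def reversal_mat_def)
  also have "\<dots> = (\<Sum>l = 0..<r. if l = r - 1 - i then X $$ (l, j) else 0)"
    using assms(2) by (intro sum.cong) auto
  finally show ?thesis using assms(2) by simp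
qed

lemma reversal_conj_index:
  assumes S: "S \<in> carrier_mat r r" and "i < r" "j < r"
  shows "(reversal_mat r * S * reversal_mat r) $$ (i, j) = S $$ (r - 1 - i, r - 1 - j)"
proof -
  have "reversal_mat r * S \<in> carrier_mat r r" using S reversal_mat_simps(1) by (intro mult_carrier_mat)
  from mult_reversal_index[OF this assms(2,3)] show ?thesis
    using reversal_mult_index[OF S assms(2), of "r - 1 - j"] assms(3) by simp
qed

lemma reversal_mult_reversal: "reversal_mat r * reversal_mat r = 1\<^sub>m r"
proof (rule eq_matI)
  fix i j assume "i < dim_row (1\<^sub>m r :: real mat)" "j < dim_col (1\<^sub>m r :: real mat)"
  hence "i < r" "j < r" by auto
  thus "(reversal_mat r * reversal_mat r) $$ (i, j) = 1\<^sub>m r $$ (i, j)"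
    using reversal_mat_simps(1)[of r]
    by (subst mult_reversal_index[of _ r]) (auto simp: reversal_mat_def)
qed (auto simp: reversal_mat_def)

lemma orthonormal_columns_mult:
  assumes X: "X \<in> carrier_mat m r" and Y: "Y \<in> carrier_mat r q"
    and "orthonormal_columns X" "orthonormal_columns Y"
  shows "orthonormal_columns (X * Y)"
proof -
  have XX: "X\<^sup>T * X = 1\<^sub>m r" and YY: "Y\<^sup>T * Y = 1\<^sub>m q"
    using assms by (auto simp: orthonormal_columns_def)
  have "(X * Y)\<^sup>T * (X * Y) = Y\<^sup>T * (X\<^sup>T * X) * Y"
    using X Y by (simp add: transpose_mult assoc_mult_mat[of _ q r _ m _ q]
        assoc_mult_mat[of _ q r _ r _ q] assoc_mult_mat[of _ r m _ r _ q])
  thus ?thesis using X Y XX YY by (simp add: orthonormal_columns_def)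
qed

lemma orthonormal_columns_reversal: "orthonormal_columns (reversal_mat r)"
  using reversal_mat_simps[of r] by (simp add: orthonormal_columns_def reversal_mult_reversal)

text \<open>The reversal is symmetric and its own inverse, so the inserted factors cancel in
  pairs.\<close>

lemma reversal_svd_product:
  assumes "U \<in> carrier_mat m r" "S \<in> carrier_mat r r" "V \<in> carrier_mat n r"
  shows "(U * reversal_mat r) * (reversal_mat r * S * reversal_mat r) * (V * reversal_mat r)\<^sup>T =
    U * S * V\<^sup>T"
proof -
  let ?J = "reversal_mat r"
  have J: "?J \<in> carrier_mat r r" by (rule reversal_mat_simps)
  have VJ: "(V * ?J)\<^sup>T = ?J * V\<^sup>T" using transpose_mult[OF assms(3) J] by (simp add: reversal_mat_simps)
  have "(U * ?J) * (?J * S * ?J) * (?J * V\<^sup>T) = U * (?J * ?J) * S * (?J * ?J) * V\<^sup>T"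
    using assms J by (simp add: assoc_mult_mat[of _ m r _ r _ r] assoc_mult_mat[of _ r r _ r _ r]
        assoc_mult_mat[of _ m r _ r _ n] assoc_mult_mat[of _ r r _ r _ n])
  thus ?thesis using assms by (simp add: VJ reversal_mult_reversal)
qed

lemma transpose_svd_product:
  fixes U S V :: "'a :: comm_semiring_0 mat"
  assumes "U \<in> carrier_mat m r" "S \<in> carrier_mat r r" "S\<^sup>T = S" "V \<in> carrier_mat n r"
  shows "(U * S * V\<^sup>T)\<^sup>T = V * S * U\<^sup>T"
  using assms by (simp add: transpose_mult[of _ m r _ n] transpose_mult[of _ r r _ n]
      assoc_mult_mat[of _ m r _ r _ n] assoc_mult_mat[of _ n r _ r _ m])

lemma diagonal_mat_reversal:
  assumes S: "S \<in> carrier_mat r r" and d: "diagonal_mat S"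
  shows "diagonal_mat (reversal_mat r * S * reversal_mat r)"
  unfolding diagonal_mat_def
proof (intro allI impI)
  fix i j
  assume "i < dim_row (reversal_mat r * S * reversal_mat r)"
    "j < dim_col (reversal_mat r * S * reversal_mat r)" "i \<noteq> j"
  \<comment> \<open>Below \<open>r\<close> the truncated differences \<open>r - 1 - i\<close> and
    \<open>r - 1 - j\<close> remain distinct.\<close>
  moreover from this have "i < r" "j < r" by (auto simp: reversal_mat_def)
  ultimately show "(reversal_mat r * S * reversal_mat r) $$ (i, j) = 0"
    using S d by (subst reversal_conj_index[OF S]) (auto simp: diagonal_mat_def)
qed

text \<open>Transposition exchanges the left and right factors, and reversal turns ascending values
  into descending ones. The size condition of \<open>svd\<close> follows from the rank.\<close>

lemma eigSVD_reversed_svd: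
  assumes B: "B \<in> carrier_mat r n" and rk: "full_column_rank (B\<^sup>T)" and "(V, S, U) \<in> eigSVD (B\<^sup>T)"
  shows "(U * reversal_mat r, reversal_mat r * S * reversal_mat r, V * reversal_mat r) \<in> svd B"
proof -
  let ?J = "reversal_mat r"
  have J: "?J \<in> carrier_mat r r" by (rule reversal_mat_simps)
  have BT: "B\<^sup>T \<in> carrier_mat n r" using B by simp
  have U: "U \<in> carrier_mat r r" "orthonormal_columns U" and V: "V \<in> carrier_mat n r" "orthonormal_columns V"
    and S: "S \<in> carrier_mat r r" "diagonal_mat S" and S0: "\<And>i. i < r \<Longrightarrow> 0 \<le> S $$ (i, i)"
    and asc: "\<And>i j. j < r \<Longrightarrow> i \<le> j \<Longrightarrow> S $$ (i, i) \<le> S $$ (j, j)" and eq: "B\<^sup>T = V * S * U\<^sup>T"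
    using assms(3) unfolding eigSVD_iff[OF BT rk] by auto
  have "B = U * S * V\<^sup>T"
    using transpose_svd_product[OF V(1) S(1) diagonal_mat_transpose[OF S] U(1)] eq
    by (metis transpose_transpose)
  hence "B = (U * ?J) * (?J * S * ?J) * (V * ?J)\<^sup>T" using reversal_svd_product[OF U(1) S(1) V(1)] by simp
  moreover have "r \<le> n" using full_column_rank_dim_le[OF rk] B by simp
  moreover note idx = reversal_conj_index[OF S(1)]
  have "0 \<le> (?J * S * ?J) $$ (i, i)" if "i < r" for i
    using idx[OF that that] S0[of "r - 1 - i"] that by simp
  moreover have "(?J * S * ?J) $$ (j, j) \<le> (?J * S * ?J) $$ (i, i)" if "j < r" "i \<le> j" for i j
    using idx[of j j] idx[of i i] asc[of "r - 1 - i" "r - 1 - j"] that by simp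
  ultimately show ?thesis
    using B U V S J diagonal_mat_reversal[OF S] orthonormal_columns_mult[OF _ J _ orthonormal_columns_reversal]
    by (auto simp: svd_def Let_def simp del: index_mult_mat(1))
qed

lemma svd_reversed_eigSVD:
  assumes B: "B \<in> carrier_mat r n" and rk: "full_column_rank (B\<^sup>T)" and "(U, S, V) \<in> svd B"
  shows "(V * reversal_mat r, reversal_mat r * S * reversal_mat r, U * reversal_mat r) \<in> eigSVD (B\<^sup>T)"
proof -
  let ?J = "reversal_mat r"
  have J: "?J \<in> carrier_mat r r" by (rule reversal_mat_simps)
  have BT: "B\<^sup>T \<in> carrier_mat n r" using B by simp
  have U: "U \<in> carrier_mat r r" "orthonormal_columns U" and V: "V \<in> carrier_mat n r" "orthonormal_columns V"
    and S: "S \<in> carrier_mat r r" "diagonal_mat S" and S0: "\<And>i. i < r \<Longrightarrow> 0 \<le> S $$ (i, i)"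
    and desc: "\<And>i j. j < r \<Longrightarrow> i \<le> j \<Longrightarrow> S $$ (j, j) \<le> S $$ (i, i)" and eq: "B = U * S * V\<^sup>T"
    using assms(3) B by (auto simp: svd_def Let_def)
  have "B\<^sup>T = V * S * U\<^sup>T"
    using transpose_svd_product[OF U(1) S(1) diagonal_mat_transpose[OF S] V(1)] eq by simp
  hence "B\<^sup>T = (V * ?J) * (?J * S * ?J) * (U * ?J)\<^sup>T" using reversal_svd_product[OF V(1) S(1) U(1)] by simp
  moreover note idx = reversal_conj_index[OF S(1)]
  have "0 \<le> (?J * S * ?J) $$ (i, i)" if "i < r" for i
    using idx[OF that that] S0[of "r - 1 - i"] that by simp
  moreover have "(?J * S * ?J) $$ (i, i) \<le> (?J * S * ?J) $$ (j, j)" if "j < r" "i \<le> j" for i j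
    using idx[of j j] idx[of i i] desc[of "r - 1 - i" "r - 1 - j"] that by simp
  ultimately show ?thesis
    unfolding eigSVD_iff[OF BT rk]
    using U V S J diagonal_mat_reversal[OF S] orthonormal_columns_mult[OF _ J _ orthonormal_columns_reversal]
    by (auto simp del: index_mult_mat(1))
qed

section \<open>Windows of consecutive rows and columns\<close>

text \<open>\<open>pick\<close> enumerates a set in increasing order, and exactly \<open>j\<close>
  elements of the window precede \<open>s + j\<close>.\<close>

lemma pick_atLeastLessThan:
  assumes "j < k"
  shows "pick {s..<s + k} j = s + j"
proof -
  have "{a \<in> {s..<s + k}. a < s + j} = {s..<s + j}" using assms by auto
  thus ?thesis using pick_card_in_set[of "s + j" "{s..<s + k}"] assms by simp
qed

lemma card_below_atLeastLessThan:
  assumes "s + k \<le> r"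
  shows "card {i. i < r \<and> i \<in> {s..<s + k}} = k"
proof -
  have "{i. i < r \<and> i \<in> {s..<s + k}} = {s..<s + k}" using assms by auto
  thus ?thesis by simp
qed

lemma submatrix_columns:
  assumes "X \<in> carrier_mat m r" "s + k \<le> r"
  shows "submatrix X UNIV {s..<s + k} = mat m k (\<lambda>(i, j). X $$ (i, s + j))"
  using assms card_below_atLeastLessThan[OF assms(2)]
  by (intro eq_matI) (simp_all add: submatrix_def pick_UNIV pick_atLeastLessThan)

lemma submatrix_block:
  assumes "X \<in> carrier_mat r r" "s + k \<le> r"
  shows "submatrix X {s..<s + k} {s..<s + k} = mat k k (\<lambda>(i, j). X $$ (s + i, s + j))"
  using assms card_below_atLeastLessThan[OF assms(2)]
  by (intro eq_matI) (simp_all add: submatrix_def pick_atLeastLessThan)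

text \<open>rSVD-PI selects columns before multiplying by \<open>Q\<close>, the basic algorithm
  afterwards; this reconciles the two orders.\<close>

lemma submatrix_columns_mult:
  assumes "Q \<in> carrier_mat m r" "U \<in> carrier_mat r q" "s + k \<le> q"
  shows "Q * submatrix U UNIV {s..<s + k} = submatrix (Q * U) UNIV {s..<s + k}"
proof -
  have "Q * U \<in> carrier_mat m q" using assms by simp
  from submatrix_columns[OF this assms(3)] show ?thesis
    using assms by (intro eq_matI) (auto simp: submatrix_columns[OF assms(2,3)] scalar_prod_def)
qed

text \<open>The window holds the last \<open>k\<close> columns. Its column \<open>k - 1 - j\<close>
  is column \<open>s + (k - 1 - j) = (k + s) - 1 - j\<close> of \<open>X\<close>, which becomes
  column \<open>j\<close> when all columns are reversed.\<close>

lemma submatrix_columns_reversal: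
  assumes X: "X \<in> carrier_mat m (k + s)"
  shows "submatrix X UNIV {s..<s + k} * reversal_mat k =
    submatrix (X * reversal_mat (k + s)) UNIV {..<k}" (is "?Y * _ = submatrix ?Z _ _")
proof -
  have Y: "?Y = mat m k (\<lambda>(i, j). X $$ (i, s + j))" using X by (rule submatrix_columns) simp
  have Z: "?Z \<in> carrier_mat m (k + s)" using X reversal_mat_simps(1) by (rule mult_carrier_mat)
  have *: "submatrix ?Z UNIV {..<k} = mat m k (\<lambda>(i, j). ?Z $$ (i, j))"
    using submatrix_columns[OF Z, of 0 k] by (simp add: atLeast0LessThan)
  show ?thesis
  proof (rule eq_matI)
    fix i j assume "i < dim_row (submatrix ?Z UNIV {..<k})" "j < dim_col (submatrix ?Z UNIV {..<k})"
    hence ij: "i < m" "j < k" by (auto simp: *)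
    have "(?Y * reversal_mat k) $$ (i, j) = ?Y $$ (i, k - 1 - j)"
      using ij by (intro mult_reversal_index) (auto simp: Y)
    also have "\<dots> = ?Z $$ (i, j)"
      using ij X by (subst mult_reversal_index[OF X]) (auto simp: Y intro!: arg_cong[of _ _ "\<lambda>x. X $$ (i, x)"])
    finally show "(?Y * reversal_mat k) $$ (i, j) = submatrix ?Z UNIV {..<k} $$ (i, j)"
      using ij by (simp add: *)
  qed (simp_all add: * Y reversal_mat_simps)
qed

lemma submatrix_block_reversal:
  assumes S: "S \<in> carrier_mat (k + s) (k + s)"
  shows "reversal_mat k * submatrix S {s..<s + k} {s..<s + k} * reversal_mat k =
    submatrix (reversal_mat (k + s) * S * reversal_mat (k + s)) {..<k} {..<k}"
    (is "_ * ?Y * _ = submatrix ?Z _ _")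
proof -
  have Y: "?Y = mat k k (\<lambda>(i, j). S $$ (s + i, s + j))" using S by (rule submatrix_block) simp
  have Z: "?Z \<in> carrier_mat (k + s) (k + s)"
    using S reversal_mat_simps(1) by (intro mult_carrier_mat)
  have *: "submatrix ?Z {..<k} {..<k} = mat k k (\<lambda>(i, j). ?Z $$ (i, j))"
    using submatrix_block[OF Z, of 0 k] by (simp add: atLeast0LessThan)
  show ?thesis
  proof (rule eq_matI)
    fix i j assume "i < dim_row (submatrix ?Z {..<k} {..<k})" "j < dim_col (submatrix ?Z {..<k} {..<k})"
    hence ij: "i < k" "j < k" by (auto simp: *)
    have "(reversal_mat k * ?Y * reversal_mat k) $$ (i, j) = ?Y $$ (k - 1 - i, k - 1 - j)"
      using ij by (intro reversal_conj_index) (auto simp: Y)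
    also have "\<dots> = S $$ (k + s - 1 - i, k + s - 1 - j)"
      using ij by (simp add: Y) (rule arg_cong2[of _ _ _ _ "\<lambda>x y. S $$ (x, y)"]; simp)
    also have "\<dots> = ?Z $$ (i, j)"
      using ij by (subst reversal_conj_index[OF S]) auto
    finally show "(reversal_mat k * ?Y * reversal_mat k) $$ (i, j) = submatrix ?Z {..<k} {..<k} $$ (i, j)"
      using ij by (simp add: *)
  qed (simp_all add: * reversal_mat_simps)
qed

text \<open>Windows at the end become windows at the start. This brings a reversed output of rSVD-PI
  into the shape of an output of basic rSVD.\<close>

lemma reverse_triplets_submatrix:
  assumes Q: "Q \<in> carrier_mat m (k + s)" and U: "U \<in> carrier_mat (k + s) (k + s)"
    and S: "S \<in> carrier_mat (k + s) (k + s)" and V: "V \<in> carrier_mat n (k + s)"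
  defines "J \<equiv> reversal_mat (k + s)"
  shows "reverse_triplets k
      (Q * submatrix U UNIV {s..<s + k}, submatrix S {s..<s + k} {s..<s + k}, submatrix V UNIV {s..<s + k}) =
    (submatrix (Q * (U * J)) UNIV {..<k}, submatrix (J * S * J) {..<k} {..<k}, submatrix (V * J) UNIV {..<k})"
proof -
  have "Q * U \<in> carrier_mat m (k + s)" using Q U by simp
  moreover have "Q * (U * J) = Q * U * J"
    using Q U reversal_mat_simps(1) by (simp add: J_def assoc_mult_mat[of _ m "k + s" _ "k + s" _ "k + s"])
  moreover have "Q * submatrix U UNIV {s..<s + k} = submatrix (Q * U) UNIV {s..<s + k}"
    using Q U by (rule submatrix_columns_mult) simp
  ultimately show ?thesis
    using submatrix_columns_reversal[of "Q * U" m k s] submatrix_columns_reversal[OF V]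
      submatrix_block_reversal[OF S]
    by (simp add: reverse_triplets_def J_def)
qed

section \<open>Change of orthonormal basis and the equivalence\<close>

text \<open>Equal column spaces give the factor \<open>M\<close>, and \<open>M\<^sup>T * M =
  M\<^sup>T * (Q'\<^sup>T * Q') * M = Q\<^sup>T * Q\<close> is the identity.\<close>

lemma orth_change_of_basis:
  assumes X: "X \<in> carrier_mat m r" and Q: "Q \<in> orth X" and Q': "Q' \<in> orth X"
  obtains M where "M \<in> carrier_mat r r" "orthonormal_columns M" "Q = Q' * M"
proof -
  note Q = orth_dims[OF Q X] and Q' = orth_dims[OF Q' X]
  obtain M where M: "M \<in> carrier_mat r r" "Q = Q' * M"
    using col_space_subset_factor[OF Q'(1) Q(1)] Q(3) Q'(3) by auto
  have QQ: "Q'\<^sup>T * Q' = 1\<^sub>m r" "Q\<^sup>T * Q = 1\<^sub>m r"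
    using Q Q' by (auto simp: orthonormal_columns_def)
  have "Q\<^sup>T * Q = M\<^sup>T * (Q'\<^sup>T * Q') * M"
    unfolding M(2) using M(1) Q'(1) by (simp add: transpose_mult assoc_mult_mat[of _ r r _ m _ r]
        assoc_mult_mat[of _ r r _ r _ r] assoc_mult_mat[of _ r m _ r _ r])
  hence "orthonormal_columns M" using QQ M(1) by (simp add: orthonormal_columns_def)
  with M show ?thesis using that by blast
qed

lemma svd_carrier:
  assumes "(U, S, V) \<in> svd B" and "B \<in> carrier_mat r n"
  shows "U \<in> carrier_mat r r" "S \<in> carrier_mat r r" "V \<in> carrier_mat n r"
  using assms by (auto simp: svd_def Let_def)

lemma svd_left_mult:
  assumes B: "B \<in> carrier_mat r n" and M: "M \<in> carrier_mat r r" "orthonormal_columns M"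
    and svd: "(U, S, V) \<in> svd B"
  shows "(M * U, S, V) \<in> svd (M * B)"
proof -
  have U: "U \<in> carrier_mat r r" "orthonormal_columns U" and V: "V \<in> carrier_mat n r"
    and S: "S \<in> carrier_mat r r" and eq: "B = U * S * V\<^sup>T"
    using svd B by (auto simp: svd_def Let_def)
  have "M * B = M * U * S * V\<^sup>T"
    unfolding eq using M U V S by (simp add: assoc_mult_mat[of _ r r _ r _ r] assoc_mult_mat[of _ r r _ r _ n])
  thus ?thesis using svd B M U orthonormal_columns_mult[OF M(1) U(1) M(2) U(2)]
    by (auto simp: svd_def Let_def)
qed

theorem theorem1:
  fixes A \<Omega> :: "real mat" and m n k s p :: nat
  assumes "A \<in> carrier_mat m n"
    and "\<Omega> \<in> carrier_mat n (k + s)"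
    and "k \<ge> 1"
    and "full_column_rank (A * \<Omega>)"
  shows "reverse_triplets k ` rsvd_pi A \<Omega> k s p = basic_rsvd A \<Omega> k s p"
proof -
  define r where "r = k + s"
  define W where "W = power_iterate A (A * \<Omega>) p"
  note A = assms(1)
  have X: "A * \<Omega> \<in> carrier_mat m r" using assms by (simp add: r_def)
  have sub: "vec_space.col_space m (A * \<Omega>) \<subseteq> vec_space.col_space m A"
    using assms(2) by (auto simp: col_space_mult[OF A assms(2)] col_space_eq_image[OF A]
        col_space_eq_image[OF assms(2)])
  note hyps = A X assms(4) sub
  have W: "W \<in> carrier_mat m r" "vec_space.col_space m W \<subseteq> vec_space.col_space m A"
    using power_iterate_invariant[OF hyps, of p] by (auto simp: W_def)
  note basic = basic_rsvd_loop_iff[OF hyps, of p, folded W_def]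
  \<comment> \<open>The transpose of \<open>Q\<^sup>T * A\<close> is \<open>A\<^sup>T * Q\<close>,
    whose full rank makes the final eigSVD applicable.\<close>
  have B: "Q\<^sup>T * A \<in> carrier_mat r n" "full_column_rank ((Q\<^sup>T * A)\<^sup>T)" if "Q \<in> orth W" for Q
  proof -
    note Q = orth_dims[OF that W(1)]
    show "Q\<^sup>T * A \<in> carrier_mat r n" using Q A by simp
    have "(Q\<^sup>T * A)\<^sup>T = A\<^sup>T * Q" using Q A by (simp add: transpose_mult[of _ r m _ n])
    thus "full_column_rank ((Q\<^sup>T * A)\<^sup>T)"
      using full_column_rank_transpose_mult(1)[OF A Q(1) Q(4)] Q(3) W(2) by simp
  qed
  have J: "reversal_mat r \<in> carrier_mat r r" by (rule reversal_mat_simps)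
  show ?thesis
  proof (intro equalityI subsetI)
    fix x assume "x \<in> reverse_triplets k ` rsvd_pi A \<Omega> k s p"
    then obtain Q1 Q S1 V1 U S V where loop: "(rsvd_pi_step A ^^ p) (A * \<Omega>) Q1"
      and Q1: "(Q, S1, V1) \<in> eigSVD Q1" and svd: "(V, S, U) \<in> eigSVD ((Q\<^sup>T * A)\<^sup>T)"
      and x: "x = reverse_triplets k (Q * submatrix U UNIV {s..<s + k},
        submatrix S {s..<s + k} {s..<s + k}, submatrix V UNIV {s..<s + k})"
      by (auto simp: rsvd_pi_def)
    have Q: "Q \<in> orth W" unfolding W_def using eigSVD_power_orth[OF hyps loop Q1] .
    have BT: "(Q\<^sup>T * A)\<^sup>T \<in> carrier_mat n r" using B(1)[OF Q] by simp
    have "U \<in> carrier_mat r r" "S \<in> carrier_mat r r" "V \<in> carrier_mat n r"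
      using svd unfolding eigSVD_iff[OF BT B(2)[OF Q]] by auto
    from reverse_triplets_submatrix[OF orth_dims(1)[OF Q W(1), unfolded r_def] this[unfolded r_def]]
    have "x = (submatrix (Q * (U * reversal_mat r)) UNIV {..<k},
      submatrix (reversal_mat r * S * reversal_mat r) {..<k} {..<k},
      submatrix (V * reversal_mat r) UNIV {..<k})" unfolding x r_def .
    \<comment> \<open>In this direction no change of basis is needed: the basic loop can reach the
      very same \<open>Q\<close>.\<close>
    moreover obtain Q0 where "Q0 \<in> orth (A * \<Omega>)" "(basic_rsvd_step A ^^ p) Q0 Q"
      using basic Q by blast
    moreover note eigSVD_reversed_svd[OF B[OF Q] svd]
    ultimately show "x \<in> basic_rsvd A \<Omega> k s p" unfolding basic_rsvd_def by blast
  next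
    fix x assume "x \<in> basic_rsvd A \<Omega> k s p"
    then obtain Q0 Q U S V where "Q0 \<in> orth (A * \<Omega>)" "(basic_rsvd_step A ^^ p) Q0 Q"
      and svd: "(U, S, V) \<in> svd (Q\<^sup>T * A)"
      and x: "x = (submatrix (Q * U) UNIV {..<k}, submatrix S {..<k} {..<k}, submatrix V UNIV {..<k})"
      by (auto simp: basic_rsvd_def)
    hence Q: "Q \<in> orth W" using basic by blast
    \<comment> \<open>The given \<open>Q\<close> need not arise in rSVD-PI. Any run of its loop
      provides some basis \<open>Q'\<close> of the same space, and the orthogonal factor
      \<open>M\<close> accounts for the difference.\<close>
    obtain Q1 where loop: "(rsvd_pi_step A ^^ p) (A * \<Omega>) Q1"
      using rsvd_pi_loop_exists[OF hyps] by blast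
    obtain Q' S1 V1 where Q1: "(Q', S1, V1) \<in> eigSVD Q1"
      using eigSVD_nonempty[OF rsvd_pi_loop_col_space(1)[OF hyps loop]
          rsvd_pi_loop_full_column_rank[OF hyps loop]] by blast
    have Q': "Q' \<in> orth W" unfolding W_def using eigSVD_power_orth[OF hyps loop Q1] .
    obtain M where M: "M \<in> carrier_mat r r" "orthonormal_columns M" and QM: "Q = Q' * M"
      using orth_change_of_basis[OF W(1) Q Q'] .
    note Qc = orth_dims(1)[OF Q W(1)] and Qc' = orth_dims(1)[OF Q' W(1)]
    note UVS = svd_carrier[OF svd B(1)[OF Q]]
    \<comment> \<open>As \<open>Q\<^sup>T = M\<^sup>T * Q'\<^sup>T\<close>, multiplying by
      \<open>M\<close> cancels the change of basis.\<close>
    have MB: "M * (Q\<^sup>T * A) = Q'\<^sup>T * A"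
    proof -
      have "M * (Q\<^sup>T * A) = (M * M\<^sup>T) * (Q'\<^sup>T * A)"
        unfolding QM using M Qc' A by (simp add: transpose_mult[of _ m r _ r]
            assoc_mult_mat[of _ r r _ r _ n] assoc_mult_mat[of _ r r _ m _ n])
      thus ?thesis using orthonormal_columns_square[OF M] left_mult_one_mat[OF B(1)[OF Q']] by simp
    qed
    let ?J = "reversal_mat r"
    have "(M * U, S, V) \<in> svd (Q'\<^sup>T * A)" using svd_left_mult[OF B(1)[OF Q] M svd] MB by simp
    from svd_reversed_eigSVD[OF B[OF Q'] this]
    have eig: "(V * ?J, ?J * S * ?J, M * U * ?J) \<in> eigSVD ((Q'\<^sup>T * A)\<^sup>T)" .
    \<comment> \<open>The decomposition for rSVD-PI is already a reversed SVD, and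
      \<open>reverse_triplets\<close> reverses it again, so pairs of reversals have to
      cancel.\<close>
    have JJ: "Y * ?J * ?J = Y" if "Y \<in> carrier_mat q r" for Y q
      using that J by (simp add: assoc_mult_mat[of _ q r _ r _ r] reversal_mult_reversal)
    have "?J * (?J * S * ?J) * ?J = (?J * ?J) * S * (?J * ?J)"
      using UVS(2) J by (simp add: assoc_mult_mat[of _ r r _ r _ r])
    hence JSJ: "?J * (?J * S * ?J) * ?J = S" using UVS(2) by (simp add: reversal_mult_reversal)
    have c: "M * U * ?J \<in> carrier_mat r r" "?J * S * ?J \<in> carrier_mat r r" "V * ?J \<in> carrier_mat n r"
      using M UVS J by auto
    have "reverse_triplets k (Q' * submatrix (M * U * ?J) UNIV {s..<s + k},
        submatrix (?J * S * ?J) {s..<s + k} {s..<s + k}, submatrix (V * ?J) UNIV {s..<s + k}) =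
      (submatrix (Q' * (M * U * ?J * ?J)) UNIV {..<k}, submatrix (?J * (?J * S * ?J) * ?J) {..<k} {..<k},
        submatrix (V * ?J * ?J) UNIV {..<k})"
      using reverse_triplets_submatrix[OF Qc'[unfolded r_def] c[unfolded r_def]] unfolding r_def .
    also have "M * U * ?J * ?J = M * U" using M UVS by (intro JJ[of _ r]) simp
    also have "Q' * (M * U) = Q * U"
      unfolding QM using Qc' M UVS by (simp add: assoc_mult_mat[of _ m r _ r _ r])
    also have "?J * (?J * S * ?J) * ?J = S" by (rule JSJ)
    also have "V * ?J * ?J = V" using UVS by (intro JJ)
    finally have "x = reverse_triplets k (Q' * submatrix (M * U * ?J) UNIV {s..<s + k},
        submatrix (?J * S * ?J) {s..<s + k} {s..<s + k}, submatrix (V * ?J) UNIV {s..<s + k})"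
      unfolding x by simp
    moreover have "(Q' * submatrix (M * U * ?J) UNIV {s..<s + k},
        submatrix (?J * S * ?J) {s..<s + k} {s..<s + k}, submatrix (V * ?J) UNIV {s..<s + k})
      \<in> rsvd_pi A \<Omega> k s p"
      using loop Q1 eig unfolding rsvd_pi_def by blast
    ultimately show "x \<in> reverse_triplets k ` rsvd_pi A \<Omega> k s p" by blast
  qed
qed

end
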